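(* For any $n\ge 2$, the polynomial algebra $\mathbb{Z}[x_1,\ldots,x_n]$ is an $\mathbf{H}(S_n)$-module algebra via the natural permutation action of $S_n$ (with $s_i$ acting as the transposition exchanging $x_i$ and $x_{i+1}$) and $$D_i\mapsto \frac{1}{1-x_ix_{i+1}^{-1}}(1-s_i),\qquad i=1,\ldots,n-1$$ (the $i$-th Demazure operator). In particular, any graded component of $\mathbb{Z}[x_1,\ldots,x_n]$ is an $\mathbf{H}(S_n)$-submodule.
   Context: For $n\ge 2$, $\mathbf{H}(S_n)$ denotes the (unital associative) $\mathbb{Z}$-algebra generated by $s_i$ and $D_i$, $i=1,\ldots,n-1$, subject to the relations: (1) $s_i^2=1$, $s_iD_i+D_is_i=s_i-1$, $D_i^2=D_i$ for $i=1,\ldots,n-1$; (2) $s_js_i=s_is_j$, $D_js_i=s_iD_j$, $D_jD_i=D_iD_j$ if $|i-j|>1$; (3) $s_js_is_j=s_is_js_i$, $D_is_js_i=s_js_iD_j$, $D_js_iD_j=s_iD_jD_i+D_iD_js_i+s_iD_js_i$ if $|i-j|=1$. It is a Hopf algebra with $\Delta(s_i)=s_i\otimes s_i$, $\Delta(D_i)=D_i\otimes 1+s_i\otimes D_i$, $\varepsilon(s_i)=1$, $\varepsilon(D_i)=0$, $S(s_i)=s_i$, $S(D_i)=-s_iD_i$. Module algebra is meant in the usual sense with respect to this Hopf structure. Graded components are with respect to total degree, $\deg x_i=1$. *)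

theory Defs
  imports
    "HOL-Library.Poly_Mapping"
    "HOL-Computational_Algebra.Fraction_Field"
    "HOL-Combinatorics.Transposition"
    "HOL-Algebra.QuotRing"
    "HOL-Algebra.IntRing"
    "HOL-Algebra.Module"
begin

section \<open>Integral monoid rings, free algebras and tensor products\<close>

text \<open>The monoid ring over the integers of a monoid: finite formal integer combinations of
  elements, with the bilinear extension of the monoid product.\<close>

definition monoid_ring :: "('a, 'm) monoid_scheme \<Rightarrow> ('a \<Rightarrow>\<^sub>0 int) ring" where
  "monoid_ring G =
    \<lparr>carrier = {c. Poly_Mapping.keys c \<subseteq> carrier G},
     mult = (\<lambda>c d. \<Sum>u\<in>Poly_Mapping.keys c. \<Sum>v\<in>Poly_Mapping.keys d.
       Poly_Mapping.single (u \<otimes>\<^bsub>G\<^esub> v) (Poly_Mapping.lookup c u * Poly_Mapping.lookup d v)),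
     one = Poly_Mapping.single \<one>\<^bsub>G\<^esub> 1,
     zero = 0,
     add = (+)\<rparr>"

definition free_monoid :: "'a set \<Rightarrow> 'a list monoid" where
  "free_monoid X = \<lparr>carrier = lists X, mult = (@), one = []\<rparr>"

definition free_algebra :: "'a set \<Rightarrow> ('a list \<Rightarrow>\<^sub>0 int) ring" where
  "free_algebra X = monoid_ring (free_monoid X)"

definition free_gen :: "'a \<Rightarrow> ('a list \<Rightarrow>\<^sub>0 int)" where
  "free_gen x = Poly_Mapping.single [x] 1"

text \<open>The tensor product over the integers of two rings \<open>A\<close> and \<open>B\<close>, with the product
  \<open>(a \<otimes> b)(a' \<otimes> b') = aa' \<otimes> bb'\<close>. The free abelian group on \<open>A \<times> B\<close> is a ring, namely the
  monoid ring of the product of the multiplicative monoids; the subgroup generated by the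
  bilinearity relations is a two-sided ideal of it.\<close>

definition bilinearity_relators ::
    "('a, 'm) ring_scheme \<Rightarrow> ('b, 'k) ring_scheme \<Rightarrow> ('a \<times> 'b \<Rightarrow>\<^sub>0 int) set" where
  "bilinearity_relators A B =
    {Poly_Mapping.single (a \<oplus>\<^bsub>A\<^esub> a', b) 1 - Poly_Mapping.single (a, b) 1
        - Poly_Mapping.single (a', b) 1 |
      a a' b. a \<in> carrier A \<and> a' \<in> carrier A \<and> b \<in> carrier B} \<union>
    {Poly_Mapping.single (a, b \<oplus>\<^bsub>B\<^esub> b') 1 - Poly_Mapping.single (a, b) 1
        - Poly_Mapping.single (a, b') 1 |
      a b b'. a \<in> carrier A \<and> b \<in> carrier B \<and> b' \<in> carrier B}"

definition bilinearity_ideal ::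
    "('a, 'm) ring_scheme \<Rightarrow> ('b, 'k) ring_scheme \<Rightarrow> ('a \<times> 'b \<Rightarrow>\<^sub>0 int) set" where
  "bilinearity_ideal A B = Idl\<^bsub>monoid_ring (A \<times>\<times> B)\<^esub> (bilinearity_relators A B)"

definition tensor_ring ::
    "('a, 'm) ring_scheme \<Rightarrow> ('b, 'k) ring_scheme \<Rightarrow> ('a \<times> 'b \<Rightarrow>\<^sub>0 int) set ring" where
  "tensor_ring A B = monoid_ring (A \<times>\<times> B) Quot bilinearity_ideal A B"

definition pure_tensor ::
    "('a, 'm) ring_scheme \<Rightarrow> ('b, 'k) ring_scheme \<Rightarrow> 'a \<Rightarrow> 'b \<Rightarrow> ('a \<times> 'b \<Rightarrow>\<^sub>0 int) set" where
  "pure_tensor A B a b =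
    bilinearity_ideal A B +>\<^bsub>monoid_ring (A \<times>\<times> B)\<^esub> Poly_Mapping.single (a, b) 1"


section \<open>Module algebras\<close>

text \<open>The locale \<^locale>\<open>module\<close> requires a commutative ring of scalars.\<close>

locale left_module = R?: ring + M?: abelian_group M for M (structure) +
  assumes smult_closed:
      "\<lbrakk>a \<in> carrier R; x \<in> carrier M\<rbrakk> \<Longrightarrow> a \<odot>\<^bsub>M\<^esub> x \<in> carrier M"
    and smult_l_distr:
      "\<lbrakk>a \<in> carrier R; b \<in> carrier R; x \<in> carrier M\<rbrakk> \<Longrightarrow>
       (a \<oplus> b) \<odot>\<^bsub>M\<^esub> x = a \<odot>\<^bsub>M\<^esub> x \<oplus>\<^bsub>M\<^esub> b \<odot>\<^bsub>M\<^esub> x"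
    and smult_r_distr:
      "\<lbrakk>a \<in> carrier R; x \<in> carrier M; y \<in> carrier M\<rbrakk> \<Longrightarrow>
       a \<odot>\<^bsub>M\<^esub> (x \<oplus>\<^bsub>M\<^esub> y) = a \<odot>\<^bsub>M\<^esub> x \<oplus>\<^bsub>M\<^esub> a \<odot>\<^bsub>M\<^esub> y"
    and smult_assoc:
      "\<lbrakk>a \<in> carrier R; b \<in> carrier R; x \<in> carrier M\<rbrakk> \<Longrightarrow>
       (a \<otimes> b) \<odot>\<^bsub>M\<^esub> x = a \<odot>\<^bsub>M\<^esub> (b \<odot>\<^bsub>M\<^esub> x)"
    and smult_one:
      "x \<in> carrier M \<Longrightarrow> \<one> \<odot>\<^bsub>M\<^esub> x = x"

text \<open>A module algebra over a ring \<open>R\<close> with coproduct \<open>\<Delta>\<close> and counit \<open>\<epsilon>\<close>: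
  \<open>h(xy) = \<Sum> h\<^sub>1(x) h\<^sub>2(y)\<close> and \<open>h(1) = \<epsilon>(h) 1\<close>. Sweedler's notation is rendered by
  quantifying over all ways of writing \<open>\<Delta>(h)\<close> as a finite sum of pure tensors.\<close>

locale module_algebra = left_module R M + M: ring M
  for R (structure) and M (structure) +
  fixes \<Delta> :: "'a \<Rightarrow> ('a \<times> 'a \<Rightarrow>\<^sub>0 int) set" and \<epsilon> :: "'a \<Rightarrow> int"
  assumes smult_mult:
      "\<And>h x y (J :: nat set) u v.
       \<lbrakk>h \<in> carrier R; x \<in> carrier M; y \<in> carrier M;
        finite J; u \<in> J \<rightarrow> carrier R; v \<in> J \<rightarrow> carrier R;
        \<Delta> h = (\<Oplus>\<^bsub>tensor_ring R R\<^esub>j\<in>J. pure_tensor R R (u j) (v j))\<rbrakk> \<Longrightarrow>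
       h \<odot>\<^bsub>M\<^esub> (x \<otimes>\<^bsub>M\<^esub> y) = (\<Oplus>\<^bsub>M\<^esub>j\<in>J. (u j \<odot>\<^bsub>M\<^esub> x) \<otimes>\<^bsub>M\<^esub> (v j \<odot>\<^bsub>M\<^esub> y))"
    and smult_unit:
      "h \<in> carrier R \<Longrightarrow> h \<odot>\<^bsub>M\<^esub> \<one>\<^bsub>M\<^esub> = [\<epsilon> h] \<cdot>\<^bsub>M\<^esub> \<one>\<^bsub>M\<^esub>"


section \<open>The Hopf algebra \<open>H(S\<^sub>n)\<close>\<close>

datatype hecke_gen = S_gen nat | D_gen nat

definition hecke_gens :: "nat \<Rightarrow> hecke_gen set" where
  "hecke_gens n = S_gen ` {1..n-1} \<union> D_gen ` {1..n-1}"

inductive_set hecke_relations ::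
    "nat \<Rightarrow> ('a, 'm) ring_scheme \<Rightarrow> (nat \<Rightarrow> 'a) \<Rightarrow> (nat \<Rightarrow> 'a) \<Rightarrow> ('a \<times> 'a) set"
  for n :: nat and R (structure) and s D where
    s_square: "i \<in> {1..n-1} \<Longrightarrow> (s i \<otimes> s i, \<one>) \<in> hecke_relations n R s D"
  | s_D: "i \<in> {1..n-1} \<Longrightarrow>
      (s i \<otimes> D i \<oplus> D i \<otimes> s i, s i \<ominus> \<one>) \<in> hecke_relations n R s D"
  | D_square: "i \<in> {1..n-1} \<Longrightarrow> (D i \<otimes> D i, D i) \<in> hecke_relations n R s D"
  | s_s_far: "\<lbrakk>i \<in> {1..n-1}; j \<in> {1..n-1}; \<bar>int i - int j\<bar> > 1\<rbrakk> \<Longrightarrow>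
      (s j \<otimes> s i, s i \<otimes> s j) \<in> hecke_relations n R s D"
  | D_s_far: "\<lbrakk>i \<in> {1..n-1}; j \<in> {1..n-1}; \<bar>int i - int j\<bar> > 1\<rbrakk> \<Longrightarrow>
      (D j \<otimes> s i, s i \<otimes> D j) \<in> hecke_relations n R s D"
  | D_D_far: "\<lbrakk>i \<in> {1..n-1}; j \<in> {1..n-1}; \<bar>int i - int j\<bar> > 1\<rbrakk> \<Longrightarrow>
      (D j \<otimes> D i, D i \<otimes> D j) \<in> hecke_relations n R s D"
  | s_s_s: "\<lbrakk>i \<in> {1..n-1}; j \<in> {1..n-1}; \<bar>int i - int j\<bar> = 1\<rbrakk> \<Longrightarrow>
      (s j \<otimes> s i \<otimes> s j, s i \<otimes> s j \<otimes> s i) \<in> hecke_relations n R s D"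
  | D_s_s: "\<lbrakk>i \<in> {1..n-1}; j \<in> {1..n-1}; \<bar>int i - int j\<bar> = 1\<rbrakk> \<Longrightarrow>
      (D i \<otimes> s j \<otimes> s i, s j \<otimes> s i \<otimes> D j) \<in> hecke_relations n R s D"
  | D_s_D: "\<lbrakk>i \<in> {1..n-1}; j \<in> {1..n-1}; \<bar>int i - int j\<bar> = 1\<rbrakk> \<Longrightarrow>
      (D j \<otimes> s i \<otimes> D j,
       s i \<otimes> D j \<otimes> D i \<oplus> D i \<otimes> D j \<otimes> s i \<oplus> s i \<otimes> D j \<otimes> s i) \<in> hecke_relations n R s D"

abbreviation hecke_free :: "nat \<Rightarrow> (hecke_gen list \<Rightarrow>\<^sub>0 int) ring" where
  "hecke_free n \<equiv> free_algebra (hecke_gens n)"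

definition hecke_ideal :: "nat \<Rightarrow> (hecke_gen list \<Rightarrow>\<^sub>0 int) set" where
  "hecke_ideal n = Idl\<^bsub>hecke_free n\<^esub>
    {a \<ominus>\<^bsub>hecke_free n\<^esub> b | a b.
      (a, b) \<in> hecke_relations n (hecke_free n) (free_gen \<circ> S_gen) (free_gen \<circ> D_gen)}"

type_synonym hecke_elem = "(hecke_gen list \<Rightarrow>\<^sub>0 int) set"

definition hecke_algebra :: "nat \<Rightarrow> hecke_elem ring" where
  "hecke_algebra n = hecke_free n Quot hecke_ideal n"

definition hecke_s :: "nat \<Rightarrow> nat \<Rightarrow> hecke_elem" where
  "hecke_s n i = hecke_ideal n +>\<^bsub>hecke_free n\<^esub> free_gen (S_gen i)"

definition hecke_D :: "nat \<Rightarrow> nat \<Rightarrow> hecke_elem" where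
  "hecke_D n i = hecke_ideal n +>\<^bsub>hecke_free n\<^esub> free_gen (D_gen i)"

text \<open>Since the \<open>s\<^sub>i\<close> and \<open>D\<^sub>i\<close> generate the algebra, the following conditions determine the
  coproduct and the counit on the carrier.\<close>

definition hecke_coproduct :: "nat \<Rightarrow> hecke_elem \<Rightarrow> (hecke_elem \<times> hecke_elem \<Rightarrow>\<^sub>0 int) set" where
  "hecke_coproduct n = (SOME \<Delta>.
    let H = hecke_algebra n; T = tensor_ring H H; s = hecke_s n; D = hecke_D n in
      \<Delta> \<in> ring_hom H T \<and>
      (\<forall>i\<in>{1..n-1}.
        \<Delta> (s i) = pure_tensor H H (s i) (s i) \<and>
        \<Delta> (D i) = pure_tensor H H (D i) \<one>\<^bsub>H\<^esub> \<oplus>\<^bsub>T\<^esub> pure_tensor H H (s i) (D i)))"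

definition hecke_counit :: "nat \<Rightarrow> hecke_elem \<Rightarrow> int" where
  "hecke_counit n = (SOME \<epsilon>.
    \<epsilon> \<in> ring_hom (hecke_algebra n) \<Z> \<and>
    (\<forall>i\<in>{1..n-1}. \<epsilon> (hecke_s n i) = 1 \<and> \<epsilon> (hecke_D n i) = 0))"


section \<open>Polynomials\<close>

text \<open>Integral polynomials in variables indexed by natural numbers, as finitely supported
  coefficient functions on monomials, a monomial being its finitely supported exponent vector.\<close>

type_synonym zpoly = "(nat \<Rightarrow>\<^sub>0 nat) \<Rightarrow>\<^sub>0 int"

definition Var :: "nat \<Rightarrow> zpoly" where
  "Var i = Poly_Mapping.single (Poly_Mapping.single i 1) 1"

text \<open>The ring \<open>\<int>[x\<^sub>1, \<dots>, x\<^sub>n]\<close>, endowed with a scalar multiplication \<open>act\<close>.\<close>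

definition poly_module :: "nat \<Rightarrow> ('h \<Rightarrow> zpoly \<Rightarrow> zpoly) \<Rightarrow> ('h, zpoly) module" where
  "poly_module n act =
    \<lparr>carrier = {p. \<forall>m\<in>Poly_Mapping.keys p. Poly_Mapping.keys m \<subseteq> {1..n}},
     mult = (*), one = 1, zero = 0, add = (+), smult = act\<rparr>"

definition graded_component :: "nat \<Rightarrow> nat \<Rightarrow> zpoly set" where
  "graded_component n d =
    {p. \<forall>m\<in>Poly_Mapping.keys p. Poly_Mapping.keys m \<subseteq> {1..n} \<and>
      (\<Sum>i\<in>Poly_Mapping.keys m. Poly_Mapping.lookup m i) = d}"

text \<open>The natural action of a permutation \<open>\<sigma>\<close>, sending \<open>x\<^sub>i\<close> to \<open>x\<^bsub>\<sigma> i\<^esub>\<close>: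
  the coefficient of \<open>\<sigma> p\<close> at an exponent vector \<open>m\<close> is that of \<open>p\<close> at \<open>m \<circ> \<sigma>\<close>.\<close>

definition permute_poly :: "(nat \<Rightarrow> nat) \<Rightarrow> zpoly \<Rightarrow> zpoly" where
  "permute_poly \<sigma> = Poly_Mapping.map_key (Poly_Mapping.map_key \<sigma>)"

lemma permute_poly_Var:
  assumes "bij \<sigma>"
  shows "permute_poly \<sigma> (Var i) = Var (\<sigma> i)"
proof -
  have inj: "inj \<sigma>" using assms by (rule bij_is_inj)
  have "inj (Poly_Mapping.map_key \<sigma> :: (nat \<Rightarrow>\<^sub>0 nat) \<Rightarrow> _)"
  proof (rule injI, rule poly_mapping_eqI)
    fix m m' :: "nat \<Rightarrow>\<^sub>0 nat" and k
    assume eq: "Poly_Mapping.map_key \<sigma> m = Poly_Mapping.map_key \<sigma> m'"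
    obtain l where "k = \<sigma> l" using assms by (meson bij_pointE)
    then show "Poly_Mapping.lookup m k = Poly_Mapping.lookup m' k"
      using arg_cong[OF eq, of "\<lambda>q. Poly_Mapping.lookup q l"] inj
      by (simp add: map_key.rep_eq)
  qed
  then have "permute_poly \<sigma> (Poly_Mapping.single m 1) = Poly_Mapping.single m' 1"
    if "Poly_Mapping.map_key \<sigma> m' = m" for m m'
    using that by (auto simp: permute_poly_def)
  moreover have "Poly_Mapping.map_key \<sigma> (Poly_Mapping.single (\<sigma> i) (1::nat))
      = Poly_Mapping.single i 1"
    using inj by simp
  ultimately show ?thesis unfolding Var_def by blast
qed

abbreviation to_fract :: "zpoly \<Rightarrow> zpoly fract" where
  "to_fract p \<equiv> Fract p 1"

text \<open>The Demazure operator, a priori with values in the field of fractions.\<close>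

definition demazure :: "nat \<Rightarrow> zpoly \<Rightarrow> zpoly fract" where
  "demazure i p =
    1 / (1 - to_fract (Var i) * inverse (to_fract (Var (i+1)))) *
      (to_fract p - to_fract (permute_poly (transpose i (i+1)) p))"

end

(* Writing s for the transposition of x_i and x_{i+1}, the operator D_i is the solution of
   (x_{i+1} - x_i) D_i p = x_{i+1} (p - s p) in polynomials: it is explicit for variables, and the rule
   D_i(pq) = D_i(p) q + s(p) D_i(q), which is the shape of the coproduct D_i \<otimes> 1 + s_i \<otimes> D_i,
   produces it for products. Hence each defining relation need only be checked on variables and shown to
   pass from p and q to pq; the latter is the same computation that makes the coproduct respect the relations.
   For the module algebra law, let \<Phi>_{x,y} be the additive map on the tensor square with
   \<Phi>_{x,y}(u \<otimes> v) = u(x) v(y); the elements h with h(xy) = \<Phi>_{x,y}(\<Delta> h) for all x, y form a subring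
   containing the generators. *)
theory Submission
  imports Defs "HOL-Algebra.Free_Abelian_Groups"
begin

section \<open>Integral monoid rings as free abelian groups, and maps out of them and their
  quotients\<close>

section \<open>Monoid rings and quotient rings\<close>

text \<open>Two obstacles lie outside the algebra. The tensor square is the quotient of a monoid
  ring by the two-sided ideal generated by the bilinearity relators, so an additive map such as
  \<Phi> descends only if it also kills all products of relators with other elements. Coproduct and
  counit are given by choice operators, so their defining equations are available only once
  homomorphisms with these values have been shown to exist; this, like the action itself, comes from
  the universal property of the presentation. For the action the target is the ring of additive
  endomorphisms of polynomials in all variables, where the operators do not depend on
  \<open>n\<close>; only afterwards is it restricted to x_1, ..., x_n. Sweedler sums are not unique,
  but any two expansions of the same tensor have the same image under \<Phi>, which is how the
  quantification over all expansions is met. Inductions run over differences instead of sums: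
  generators and their differences exhaust a free abelian group, and no separate case for negatives
  arises.\<close>

lemma frag_cmul_right_diff_distrib: "frag_cmul k (a - b) = frag_cmul k a - frag_cmul k b"
  by (rule poly_mapping_eqI) (simp add: lookup_minus algebra_simps)

lemma frag_extend_fun_diff:
  "frag_extend (\<lambda>x. f x - g x) c = frag_extend f c - frag_extend g c"
  by (simp add: frag_extend_def frag_cmul_right_diff_distrib sum_subtractf)

lemma monoid_ring_simps [simp]:
  "c \<in> carrier (monoid_ring G) \<longleftrightarrow> Poly_Mapping.keys c \<subseteq> carrier G"
  "\<one>\<^bsub>monoid_ring G\<^esub> = frag_of \<one>\<^bsub>G\<^esub>"
  "\<zero>\<^bsub>monoid_ring G\<^esub> = 0"
  "c \<oplus>\<^bsub>monoid_ring G\<^esub> d = c + d"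
  by (simp_all add: monoid_ring_def)

text \<open>\<open>frag_extend\<close> is additive both in its argument and in the function that it
  extends, so this form yields the bilinearity of the product.\<close>

lemma mult_monoid_ring:
  "c \<otimes>\<^bsub>monoid_ring G\<^esub> d =
    frag_extend (\<lambda>u. frag_extend (\<lambda>v. frag_of (u \<otimes>\<^bsub>G\<^esub> v)) d) c"
proof -
  have [simp]: "frag_cmul k (Poly_Mapping.single x l) = Poly_Mapping.single x (k * l)" for k l and x :: 'a
    by (rule poly_mapping_eqI) (simp add: lookup_single when_def)
  show ?thesis
    by (simp add: frag_extend_def monoid_ring_def frag_cmul_sum)
qed

lemma mult_monoid_ring_of [simp]:
  "frag_of x \<otimes>\<^bsub>monoid_ring G\<^esub> frag_of y = frag_of (x \<otimes>\<^bsub>G\<^esub> y)"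
  by (simp add: mult_monoid_ring)

lemma mult_monoid_ring_zero [simp]:
  "0 \<otimes>\<^bsub>monoid_ring G\<^esub> d = 0" "c \<otimes>\<^bsub>monoid_ring G\<^esub> 0 = 0"
  by (simp_all add: mult_monoid_ring frag_extend_eq_0)

lemma mult_monoid_ring_diff:
  "(c - c') \<otimes>\<^bsub>monoid_ring G\<^esub> d = c \<otimes>\<^bsub>monoid_ring G\<^esub> d - c' \<otimes>\<^bsub>monoid_ring G\<^esub> d"
  "c \<otimes>\<^bsub>monoid_ring G\<^esub> (d - d') = c \<otimes>\<^bsub>monoid_ring G\<^esub> d - c \<otimes>\<^bsub>monoid_ring G\<^esub> d'"
  by (simp_all add: mult_monoid_ring frag_extend_diff frag_extend_fun_diff)

text \<open>Through this identification the additive structure and the universal property are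
  inherited from the free abelian group.\<close>

lemma add_monoid_monoid_ring: "add_monoid (monoid_ring G) = free_Abelian_group (carrier G)"
  by (simp add: monoid_ring_def free_Abelian_group_def)

lemma diff_closed_monoid_ring:
  "c \<in> carrier (monoid_ring G) \<Longrightarrow> d \<in> carrier (monoid_ring G) \<Longrightarrow> c - d \<in> carrier (monoid_ring G)"
  using keys_diff[of c d] by auto

text \<open>Associativity and the unit laws are additive in each variable, so induction over
  differences reduces them to elements of \<open>G\<close>.\<close>

lemma ring_monoid_ring:
  assumes "monoid G"
  shows "ring (monoid_ring G)"
proof (rule ringI)
  interpret G: monoid G by fact
  let ?R = "monoid_ring G"
  show "abelian_group ?R"
    by (rule comm_group_abelian_groupI)
      (simp only: add_monoid_monoid_ring abelian_free_Abelian_group)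
  have keys_minus: "Poly_Mapping.keys (c - d) \<subseteq> carrier G"
    if "Poly_Mapping.keys c \<subseteq> carrier G" "Poly_Mapping.keys d \<subseteq> carrier G" for c d :: "'a \<Rightarrow>\<^sub>0 int"
    using keys_diff[of c d] that by blast
  show "monoid ?R"
  proof (rule monoidI)
    fix c d assume cd: "c \<in> carrier ?R" "d \<in> carrier ?R"
    then have "Poly_Mapping.keys c \<subseteq> carrier G" by simp
    then show "c \<otimes>\<^bsub>?R\<^esub> d \<in> carrier ?R"
    proof (induction c rule: frag_induction)
      case (one x)
      from cd have "Poly_Mapping.keys d \<subseteq> carrier G" by simp
      then show ?case
        by (induction d rule: frag_induction)
          (use one in \<open>auto simp: mult_monoid_ring_diff keys_minus\<close>)
    qed (auto simp: mult_monoid_ring_diff keys_minus)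
    fix e assume "e \<in> carrier ?R"
    then have e: "Poly_Mapping.keys e \<subseteq> carrier G" by simp
    from cd have c: "Poly_Mapping.keys c \<subseteq> carrier G" by simp
    from cd have d: "Poly_Mapping.keys d \<subseteq> carrier G" by simp
    from c show "c \<otimes>\<^bsub>?R\<^esub> d \<otimes>\<^bsub>?R\<^esub> e = c \<otimes>\<^bsub>?R\<^esub> (d \<otimes>\<^bsub>?R\<^esub> e)"
    proof (induction c rule: frag_induction)
      case (one x)
      note x = one
      from d show ?case
      proof (induction d rule: frag_induction)
        case (one y)
        from e show ?case
          by (induction e rule: frag_induction)
            (use x one in \<open>auto simp: mult_monoid_ring_diff G.m_assoc\<close>)
      qed (auto simp: mult_monoid_ring_diff)
    qed (auto simp: mult_monoid_ring_diff)
  next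
    fix c assume "c \<in> carrier ?R"
    then have c: "Poly_Mapping.keys c \<subseteq> carrier G" by simp
    then show "\<one>\<^bsub>?R\<^esub> \<otimes>\<^bsub>?R\<^esub> c = c"
      by (induction c rule: frag_induction) (auto simp: mult_monoid_ring_diff)
    from c show "c \<otimes>\<^bsub>?R\<^esub> \<one>\<^bsub>?R\<^esub> = c"
      by (induction c rule: frag_induction) (auto simp: mult_monoid_ring_diff)
  qed simp
next
  fix c d e
  \<comment> \<open>Distributivity over a sum is distributivity over a difference, read at
    \<open>c + d\<close> and \<open>d\<close>.\<close>
  show "(c \<oplus>\<^bsub>monoid_ring G\<^esub> d) \<otimes>\<^bsub>monoid_ring G\<^esub> e
      = c \<otimes>\<^bsub>monoid_ring G\<^esub> e \<oplus>\<^bsub>monoid_ring G\<^esub> d \<otimes>\<^bsub>monoid_ring G\<^esub> e"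
    using mult_monoid_ring_diff(1)[where c = "c + d" and c' = d and d = e and G = G] by simp
  show "e \<otimes>\<^bsub>monoid_ring G\<^esub> (c \<oplus>\<^bsub>monoid_ring G\<^esub> d)
      = e \<otimes>\<^bsub>monoid_ring G\<^esub> c \<oplus>\<^bsub>monoid_ring G\<^esub> e \<otimes>\<^bsub>monoid_ring G\<^esub> d"
    using mult_monoid_ring_diff(2)[where d = "c + d" and d' = d and c = e and G = G] by simp
qed

text \<open>Reconciles the subtraction derived from the ring structure with the pointwise one that
  the inductions produce.\<close>

lemma minus_monoid_ring:
  assumes "monoid G" "c \<in> carrier (monoid_ring G)" "d \<in> carrier (monoid_ring G)"
  shows "c \<ominus>\<^bsub>monoid_ring G\<^esub> d = c - d"
proof -
  interpret ring "monoid_ring G" using assms(1) by (rule ring_monoid_ring)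
  have "(c - d) \<oplus>\<^bsub>monoid_ring G\<^esub> d = c" by simp
  moreover have "c - d \<in> carrier (monoid_ring G)"
    using assms keys_diff[of c d] by auto
  ultimately show ?thesis
    using assms by (metis add.m_closed add.inv_closed a_assoc minus_eq r_neg r_zero)
qed

lemma monoid_ring_hom_diff:
  assumes "monoid G" "abelian_group_hom (monoid_ring G) A h"
    "c \<in> carrier (monoid_ring G)" "d \<in> carrier (monoid_ring G)"
  shows "h (c - d) = h c \<ominus>\<^bsub>A\<^esub> h d"
proof -
  interpret abelian_group_hom "monoid_ring G" A h by fact
  show ?thesis
    using assms minus_monoid_ring[OF assms(1,3,4)] hom_add
    by (metis G.a_inv_closed G.minus_eq H.minus_eq hom_a_inv)
qed

lemma monoid_ring_additive_extension:
  assumes "monoid G" "abelian_group A" "f \<in> carrier G \<rightarrow> carrier A"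
  obtains h where "abelian_group_hom (monoid_ring G) A h"
    "\<And>x. x \<in> carrier G \<Longrightarrow> h (frag_of x) = f x"
proof -
  interpret A: abelian_group A by fact
  interpret R: ring "monoid_ring G" using assms(1) by (rule ring_monoid_ring)
  have "f ` carrier G \<subseteq> carrier (add_monoid A)" using assms(3) by auto
  from comm_group.free_Abelian_group_universal[OF A.a_comm_group this]
  obtain h where h: "h \<in> hom (free_Abelian_group (carrier G)) (add_monoid A)"
    "\<And>x. x \<in> carrier G \<Longrightarrow> h (frag_of x) = f x"
    by blast
  show thesis
  proof (rule that[OF _ h(2)])
    show "abelian_group_hom (monoid_ring G) A h"
      using h(1) unfolding add_monoid_monoid_ring[symmetric]
      by (intro abelian_group_homI R.abelian_group_axioms A.abelian_group_axioms
          group_hom.intro group_hom_axioms.intro A.a_group R.a_group)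
  qed
qed

text \<open>The additive extension is multiplicative because h(cd) and h(c) h(d) are both biadditive
  in c and d and agree on monoid elements.\<close>

lemma monoid_ring_extension:
  assumes "monoid G" "ring R" "f \<in> hom G R" "f \<one>\<^bsub>G\<^esub> = \<one>\<^bsub>R\<^esub>"
  obtains h where "h \<in> ring_hom (monoid_ring G) R"
    "\<And>x. x \<in> carrier G \<Longrightarrow> h (frag_of x) = f x"
proof -
  interpret G: monoid G by fact
  interpret R: ring R by fact
  interpret Z: ring "monoid_ring G" using assms(1) by (rule ring_monoid_ring)
  have "f \<in> carrier G \<rightarrow> carrier R" using assms(3) by (auto simp: hom_def)
  then obtain h where h: "abelian_group_hom (monoid_ring G) R h"
    and hf: "\<And>x. x \<in> carrier G \<Longrightarrow> h (frag_of x) = f x"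
    using monoid_ring_additive_extension[OF assms(1) R.abelian_group_axioms] by blast
  interpret h: abelian_group_hom "monoid_ring G" R h by fact
  note diff = monoid_ring_hom_diff[OF assms(1) h]
  have mult: "h (c \<otimes>\<^bsub>monoid_ring G\<^esub> d) = h c \<otimes>\<^bsub>R\<^esub> h d"
    if "c \<in> carrier (monoid_ring G)" and d: "d \<in> carrier (monoid_ring G)" for c d
  proof -
    from that have c: "Poly_Mapping.keys c \<subseteq> carrier G" by simp
    \<comment> \<open>Membership travels along because the induction over differences does not
      supply it, while additivity of \<open>h\<close> is known only on the carrier.\<close>
    have "c \<in> carrier (monoid_ring G) \<and> h (c \<otimes>\<^bsub>monoid_ring G\<^esub> d) = h c \<otimes>\<^bsub>R\<^esub> h d"
      using c
    proof (induction c rule: frag_induction)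
      case zero
      then show ?case using d h.hom_zero h.hom_closed[OF d] by simp
    next
      case (one x)
      from d have "Poly_Mapping.keys d \<subseteq> carrier G" by simp
      then have "d \<in> carrier (monoid_ring G) \<and>
          h (frag_of x \<otimes>\<^bsub>monoid_ring G\<^esub> d) = h (frag_of x) \<otimes>\<^bsub>R\<^esub> h d"
      proof (induction d rule: frag_induction)
        case zero
        then show ?case using one h.hom_zero h.hom_closed[of "frag_of x"] by simp
      next
        case (one y)
        then show ?case using \<open>x \<in> carrier G\<close> assms(3) by (simp add: hf hom_mult)
      next
        case (diff a b)
        then have "a - b \<in> carrier (monoid_ring G)" using keys_diff[of a b] by auto
        moreover have "frag_of x \<in> carrier (monoid_ring G)" using one by simp
        ultimately show ?case
          using diff by (simp add: mult_monoid_ring_diff \<open>\<And>c d. _ \<Longrightarrow> _ \<Longrightarrow> h (c - d) = _\<close>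
            R.r_minus R.r_distr R.minus_eq del: monoid_ring_simps(1))
      qed
      then show ?case using one by simp
    next
      case (diff a b)
      then have "a - b \<in> carrier (monoid_ring G)" using keys_diff[of a b] by auto
      then show ?case
        using diff d by (simp add: mult_monoid_ring_diff \<open>\<And>c d. _ \<Longrightarrow> _ \<Longrightarrow> h (c - d) = _\<close>
          R.l_minus R.l_distr R.minus_eq del: monoid_ring_simps(1))
    qed
    then show ?thesis by blast
  qed
  show thesis
  proof (rule that[OF _ hf])
    show "h \<in> ring_hom (monoid_ring G) R"
    proof (rule ring_hom_memI)
      show "h \<one>\<^bsub>monoid_ring G\<^esub> = \<one>\<^bsub>R\<^esub>" using assms(4) by (simp add: hf)
    qed (fact mult h.hom_closed h.hom_add)+
  qed
qed

text \<open>Stated for additive maps, since the maps \<Phi> on the tensor square are merely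
  additive.\<close>

lemma (in ideal) factor_additive_hom:
  assumes "abelian_group_hom R A h" "\<And>a. a \<in> I \<Longrightarrow> h a = \<zero>\<^bsub>A\<^esub>"
  obtains g where "abelian_group_hom (R Quot I) A g"
    "\<And>x. x \<in> carrier R \<Longrightarrow> g (I +> x) = h x"
proof
  interpret h: abelian_group_hom R A h by fact
  interpret Q: ring "R Quot I" by (rule quotient_is_ring)
  \<comment> \<open>\<open>h\<close> is constant on cosets of \<open>I\<close>, so the image of a
    coset is a singleton.\<close>
  let ?g = "\<lambda>X. the_elem (h ` X)"
  show g: "?g (I +> x) = h x" if x: "x \<in> carrier R" for x
  proof -
    have "h y = h x" if y: "y \<in> I +> x" for y
    proof -
      from y obtain a where a: "a \<in> I" "y = a \<oplus> x"
        by (auto simp: a_r_coset_def')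
      with x have "h y = h a \<oplus>\<^bsub>A\<^esub> h x" using h.hom_add[of a x] a_Hcarr by simp
      with a x show ?thesis by (simp add: assms(2))
    qed
    moreover have "I +> x \<noteq> {}" using a_rcos_self[OF x] by blast
    ultimately show ?thesis by (intro the_elem_image_unique)
  qed
  show "abelian_group_hom (R Quot I) A ?g"
  proof (intro abelian_group_homI group_hom.intro group_hom_axioms.intro homI)
    fix X Y assume "X \<in> carrier (add_monoid (R Quot I))" "Y \<in> carrier (add_monoid (R Quot I))"
    then obtain x y where "x \<in> carrier R" "X = I +> x" "y \<in> carrier R" "Y = I +> y"
      by (auto simp: FactRing_def A_RCOSETS_def')
    then show "?g (X \<otimes>\<^bsub>add_monoid (R Quot I)\<^esub> Y) = ?g X \<otimes>\<^bsub>add_monoid A\<^esub> ?g Y"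
      by (simp add: FactRing_def a_rcos_sum g)
  next
    fix X assume "X \<in> carrier (add_monoid (R Quot I))"
    then obtain x where "x \<in> carrier R" "X = I +> x"
      by (auto simp: FactRing_def A_RCOSETS_def')
    then show "?g X \<in> carrier (add_monoid A)" by (simp add: g)
  qed (use Q.abelian_group_axioms Q.a_group h.H.a_group h.H.abelian_group_axioms in auto)
qed

lemma (in ideal) factor_ring_hom:
  assumes "ring S" "h \<in> ring_hom R S" "\<And>a. a \<in> I \<Longrightarrow> h a = \<zero>\<^bsub>S\<^esub>"
  obtains g where "g \<in> ring_hom (R Quot I) S"
    "\<And>x. x \<in> carrier R \<Longrightarrow> g (I +> x) = h x"
proof -
  interpret h: ring_hom_ring R S h
    by (intro ring_hom_ringI2 ring_axioms assms)
  obtain g where g: "abelian_group_hom (R Quot I) S g"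
    and gh: "\<And>x. x \<in> carrier R \<Longrightarrow> g (I +> x) = h x"
    using factor_additive_hom[OF h.abelian_group_hom_axioms assms(3)] by blast
  interpret g: abelian_group_hom "R Quot I" S g by fact
  show thesis
  proof (rule that[OF _ gh], rule ring_hom_memI)
    fix X Y assume "X \<in> carrier (R Quot I)" "Y \<in> carrier (R Quot I)"
    then obtain x y where "x \<in> carrier R" "X = I +> x" "y \<in> carrier R" "Y = I +> y"
      by (auto simp: FactRing_def A_RCOSETS_def')
    then show "g (X \<otimes>\<^bsub>R Quot I\<^esub> Y) = g X \<otimes>\<^bsub>S\<^esub> g Y"
      by (simp add: FactRing_def rcoset_mult_add gh)
  next
    show "g \<one>\<^bsub>R Quot I\<^esub> = \<one>\<^bsub>S\<^esub>" by (simp add: FactRing_def gh)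
  qed (use g.hom_add in auto)
qed

section \<open>The tensor ring and its universal property for biadditive maps\<close>

section \<open>Tensor products of rings\<close>

lemma (in abelian_group) minus_eq_zero_iff:
  assumes "a \<in> carrier G" "b \<in> carrier G"
  shows "a \<ominus> b = \<zero> \<longleftrightarrow> a = b"
  using assms by (metis a_inv_closed minus_eq minus_equality minus_minus r_neg)

lemma (in abelian_group) minus_minus_eq_zero_iff:
  assumes "a \<in> carrier G" "b \<in> carrier G" "c \<in> carrier G"
  shows "a \<ominus> b \<ominus> c = \<zero> \<longleftrightarrow> a = b \<oplus> c"
proof -
  have "a \<ominus> b \<ominus> c = a \<ominus> (b \<oplus> c)"
    using assms by (simp add: minus_eq minus_add a_ac)
  then show ?thesis using assms by (simp add: minus_eq_zero_iff)
qed

definition biadditive ::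
    "('a, 'm) ring_scheme \<Rightarrow> ('b, 'k) ring_scheme \<Rightarrow> ('c, 'l) ring_scheme \<Rightarrow> ('a \<Rightarrow> 'b \<Rightarrow> 'c) \<Rightarrow> bool" where
  "biadditive A B C \<beta> \<longleftrightarrow>
    (\<forall>a\<in>carrier A. \<forall>b\<in>carrier B. \<beta> a b \<in> carrier C) \<and>
    (\<forall>a\<in>carrier A. \<forall>a'\<in>carrier A. \<forall>b\<in>carrier B. \<beta> (a \<oplus>\<^bsub>A\<^esub> a') b = \<beta> a b \<oplus>\<^bsub>C\<^esub> \<beta> a' b) \<and>
    (\<forall>a\<in>carrier A. \<forall>b\<in>carrier B. \<forall>b'\<in>carrier B. \<beta> a (b \<oplus>\<^bsub>B\<^esub> b') = \<beta> a b \<oplus>\<^bsub>C\<^esub> \<beta> a b')"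

locale tensor_product = A: ring A + B: ring B
  for A :: "('a, 'm) ring_scheme" and B :: "('b, 'k) ring_scheme"
begin

abbreviation "Z \<equiv> monoid_ring (A \<times>\<times> B)"
abbreviation "J \<equiv> bilinearity_ideal A B"
abbreviation "T \<equiv> tensor_ring A B"
abbreviation tensor (infixl \<open>\<otimes>\<^sub>T\<close> 72) where "a \<otimes>\<^sub>T b \<equiv> pure_tensor A B a b"

lemma monoid_DirProd: "monoid (A \<times>\<times> B)"
  by (rule DirProd_monoid[OF A.monoid_axioms B.monoid_axioms])

lemma ring_Z: "ring Z"
  by (rule ring_monoid_ring[OF monoid_DirProd])

lemma keys_relators: "bilinearity_relators A B \<subseteq> carrier Z"
  unfolding bilinearity_relators_def
  by (auto dest!: subsetD[OF keys_diff])

lemma ideal_J: "ideal J Z"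
  unfolding bilinearity_ideal_def using ring.genideal_ideal[OF ring_Z keys_relators] .

lemma ring_T: "ring T"
  unfolding tensor_ring_def by (rule ideal.quotient_is_ring[OF ideal_J])

lemma proj_hom: "ring_hom_ring Z T ((+>\<^bsub>Z\<^esub>) J)"
  unfolding tensor_ring_def by (rule ideal.rcos_ring_hom_ring[OF ideal_J])

lemma proj_zero:
  assumes "x \<in> J"
  shows "J +>\<^bsub>Z\<^esub> x = \<zero>\<^bsub>T\<^esub>"
proof -
  interpret ideal J Z by (rule ideal_J)
  show ?thesis using a_rcos_const[OF assms] by (simp add: tensor_ring_def FactRing_def)
qed

lemma tensor_closed [simp]: "a \<in> carrier A \<Longrightarrow> b \<in> carrier B \<Longrightarrow> a \<otimes>\<^sub>T b \<in> carrier T"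
  unfolding pure_tensor_def
  by (rule ring_hom_closed[OF ring_hom_ring.homh[OF proj_hom]]) simp

lemma tensor_one: "\<one>\<^bsub>A\<^esub> \<otimes>\<^sub>T \<one>\<^bsub>B\<^esub> = \<one>\<^bsub>T\<^esub>"
  using ring_hom_one[OF ring_hom_ring.homh[OF proj_hom]] by (simp add: pure_tensor_def)

lemma tensor_mult [simp]:
  assumes "a \<in> carrier A" "b \<in> carrier B" "a' \<in> carrier A" "b' \<in> carrier B"
  shows "a \<otimes>\<^sub>T b \<otimes>\<^bsub>T\<^esub> a' \<otimes>\<^sub>T b' = (a \<otimes>\<^bsub>A\<^esub> a') \<otimes>\<^sub>T (b \<otimes>\<^bsub>B\<^esub> b')"
  using ring_hom_mult[OF ring_hom_ring.homh[OF proj_hom], of "frag_of (a, b)" "frag_of (a', b')"] assms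
  by (simp add: pure_tensor_def)

text \<open>Both families of relators have the shape x - y - z, so one argument covers additivity in
  either factor: the coset of a relator vanishes.\<close>

lemma tensor_relator:
  assumes "frag_of x - frag_of y - frag_of z \<in> bilinearity_relators A B"
    and xyz: "x \<in> carrier A \<times> carrier B" "y \<in> carrier A \<times> carrier B" "z \<in> carrier A \<times> carrier B"
  shows "fst x \<otimes>\<^sub>T snd x = fst y \<otimes>\<^sub>T snd y \<oplus>\<^bsub>T\<^esub> fst z \<otimes>\<^sub>T snd z"
proof -
  interpret T: ring T by (rule ring_T)
  interpret p: ring_hom_ring Z T "(+>\<^bsub>Z\<^esub>) J" by (rule proj_hom)
  note diff = monoid_ring_hom_diff[OF monoid_DirProd p.abelian_group_hom_axioms]
  have "frag_of x - frag_of y - frag_of z \<in> J"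
    using assms(1) ring.genideal_self[OF ring_Z keys_relators] by (auto simp: bilinearity_ideal_def)
  note 0 = proj_zero[OF this]
  have f: "frag_of x \<in> carrier Z" "frag_of y \<in> carrier Z" "frag_of z \<in> carrier Z"
    using xyz by auto
  note diff[OF diff_closed_monoid_ring[OF f(1,2)] f(3)] diff[OF f(1,2)]
  with 0 have "fst x \<otimes>\<^sub>T snd x \<ominus>\<^bsub>T\<^esub> fst y \<otimes>\<^sub>T snd y \<ominus>\<^bsub>T\<^esub> fst z \<otimes>\<^sub>T snd z = \<zero>\<^bsub>T\<^esub>"
    by (simp add: pure_tensor_def)
  moreover have "fst x \<otimes>\<^sub>T snd x \<in> carrier T" "fst y \<otimes>\<^sub>T snd y \<in> carrier T" "fst z \<otimes>\<^sub>T snd z \<in> carrier T"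
    using xyz by auto
  ultimately show ?thesis
    by (simp add: T.minus_minus_eq_zero_iff)
qed

lemma tensor_add_left:
  assumes "a \<in> carrier A" "a' \<in> carrier A" "b \<in> carrier B"
  shows "(a \<oplus>\<^bsub>A\<^esub> a') \<otimes>\<^sub>T b = a \<otimes>\<^sub>T b \<oplus>\<^bsub>T\<^esub> a' \<otimes>\<^sub>T b"
proof -
  have "frag_of (a \<oplus>\<^bsub>A\<^esub> a', b) - frag_of (a, b) - frag_of (a', b) \<in> bilinearity_relators A B"
    unfolding bilinearity_relators_def using assms by blast
  from tensor_relator[OF this] show ?thesis using assms by simp
qed

lemma tensor_add_right:
  assumes "a \<in> carrier A" "b \<in> carrier B" "b' \<in> carrier B"
  shows "a \<otimes>\<^sub>T (b \<oplus>\<^bsub>B\<^esub> b') = a \<otimes>\<^sub>T b \<oplus>\<^bsub>T\<^esub> a \<otimes>\<^sub>T b'"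
proof -
  have "frag_of (a, b \<oplus>\<^bsub>B\<^esub> b') - frag_of (a, b) - frag_of (a, b') \<in> bilinearity_relators A B"
    unfolding bilinearity_relators_def using assms by blast
  from tensor_relator[OF this] show ?thesis using assms by simp
qed

text \<open>Pure tensors generate the additive group of the tensor ring, so an identity between
  additive maps need only be checked on them.\<close>

lemma tensor_induct [consumes 1, case_names zero tensor diff]:
  assumes "t \<in> carrier T" and "P \<zero>\<^bsub>T\<^esub>"
    and "\<And>a b. a \<in> carrier A \<Longrightarrow> b \<in> carrier B \<Longrightarrow> P (a \<otimes>\<^sub>T b)"
    and "\<And>t u. t \<in> carrier T \<Longrightarrow> u \<in> carrier T \<Longrightarrow> P t \<Longrightarrow> P u \<Longrightarrow> P (t \<ominus>\<^bsub>T\<^esub> u)"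
  shows "P t"
proof -
  interpret p: ring_hom_ring Z T "(+>\<^bsub>Z\<^esub>) J" by (rule proj_hom)
  obtain c where c: "c \<in> carrier Z" "t = J +>\<^bsub>Z\<^esub> c"
    using assms(1) by (auto simp: tensor_ring_def FactRing_def A_RCOSETS_def')
  then have "Poly_Mapping.keys c \<subseteq> carrier A \<times> carrier B" by simp
  then have "c \<in> carrier Z \<and> P (J +>\<^bsub>Z\<^esub> c)"
  proof (induction c rule: frag_induction)
    case zero
    then show ?case using assms(2) p.hom_zero by simp
  next
    case (one x)
    then show ?case using assms(3)[of "fst x" "snd x"] by (auto simp: pure_tensor_def)
  next
    case (diff c d)
    then show ?case
      using monoid_ring_hom_diff[OF monoid_DirProd p.abelian_group_hom_axioms, of c d]
        assms(4) p.hom_closed keys_diff[of c d] by auto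
  qed
  with c show ?thesis by simp
qed

text \<open>The additive extension of \<beta> to \<open>Z\<close> kills the relators, but
  \<open>J\<close> is the two-sided ideal that they generate; the work lies in showing that products
  of relators with arbitrary elements are killed as well.\<close>

lemma biadditive_extension:
  assumes "abelian_group C" and \<beta>: "biadditive A B C \<beta>"
  obtains g where "abelian_group_hom T C g"
    "\<And>a b. a \<in> carrier A \<Longrightarrow> b \<in> carrier B \<Longrightarrow> g (a \<otimes>\<^sub>T b) = \<beta> a b"
proof -
  interpret C: abelian_group C by fact
  interpret Z: ring Z by (rule ring_Z)
  \<comment> \<open>A relation rather than a chosen extension: an extension composed with
    multiplication by a pair has to count as an extension of the correspondingly shifted
    map.\<close>
  define ext where "ext \<beta> h \<longleftrightarrow> biadditive A B C \<beta> \<and> abelian_group_hom Z C h \<and>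
    (\<forall>a\<in>carrier A. \<forall>b\<in>carrier B. h (frag_of (a, b)) = \<beta> a b)" for \<beta> h
  have ext_ex: "\<exists>h. ext \<beta> h" if "biadditive A B C \<beta>" for \<beta>
  proof -
    have "(\<lambda>(a, b). \<beta> a b) \<in> carrier (A \<times>\<times> B) \<rightarrow> carrier C"
      using that by (auto simp: biadditive_def)
    then obtain h where "abelian_group_hom Z C h"
      "\<And>x. x \<in> carrier (A \<times>\<times> B) \<Longrightarrow> h (frag_of x) = (\<lambda>(a, b). \<beta> a b) x"
      using monoid_ring_additive_extension[OF monoid_DirProd assms(1)] by blast
    then show ?thesis using that by (auto simp: ext_def)
  qed
  have ext_diff: "h (c - d) = h c \<ominus>\<^bsub>C\<^esub> h d"
    if "ext \<beta> h" "c \<in> carrier Z" "d \<in> carrier Z" for \<beta> h c d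
    using that monoid_ring_hom_diff[OF monoid_DirProd] by (auto simp: ext_def)
  have ext_add: "h (c \<oplus>\<^bsub>Z\<^esub> d) = h c \<oplus>\<^bsub>C\<^esub> h d"
    if "ext \<beta> h" "c \<in> carrier Z" "d \<in> carrier Z" for \<beta> h c d
    using that abelian_group_hom.hom_add[of Z C h c d] by (auto simp: ext_def)
  have ext_closed: "h c \<in> carrier C" if "ext \<beta> h" "c \<in> carrier Z" for \<beta> h c
    using that by (auto simp: ext_def intro: abelian_group_hom.hom_closed)
  have ext_zero: "h 0 = \<zero>\<^bsub>C\<^esub>" if "ext \<beta> h" for \<beta> h
    using that abelian_group_hom.hom_zero[of Z C h] by (simp add: ext_def)
  note closed_diff = diff_closed_monoid_ring[of _ "A \<times>\<times> B"]
  \<comment> \<open>Quantifying over all \<open>\<beta>\<close> makes the common kernel a two-sided ideal, as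
    \<open>(a, b) \<mapsto> \<beta> (ua) (vb)\<close> and \<open>(a, b) \<mapsto> \<beta> (au) (bv)\<close> are biadditive again.\<close>
  define K where "K = {c \<in> carrier Z. \<forall>\<beta> h. ext \<beta> h \<longrightarrow> h c = \<zero>\<^bsub>C\<^esub>}"
  have "ideal K Z"
  proof (rule idealI[OF ring_Z])
    show "subgroup K (add_monoid Z)"
    proof (rule Z.add.subgroupI)
      show "K \<subseteq> carrier Z" by (auto simp: K_def)
      show "K \<noteq> {}" using ext_zero by (force simp: K_def)
      fix c assume c: "c \<in> K"
      have "h (0 - c) = \<zero>\<^bsub>C\<^esub>" if "ext \<beta> h" for \<beta> h
      proof -
        have "h c = \<zero>\<^bsub>C\<^esub>" using c that by (auto simp: K_def)
        then show ?thesis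
          using ext_diff[OF that, of 0 c] c C.r_neg[OF C.zero_closed]
          by (simp add: K_def ext_zero[OF that] C.minus_eq)
      qed
      then have "0 - c \<in> K" using closed_diff[of 0 c] c by (auto simp: K_def)
      moreover have "\<ominus>\<^bsub>Z\<^esub> c = 0 - c"
        using minus_monoid_ring[OF monoid_DirProd, of 0 c] c by (simp add: K_def Z.minus_eq)
      ultimately show "\<ominus>\<^bsub>Z\<^esub> c \<in> K" by simp
    next
      fix c d assume K: "c \<in> K" "d \<in> K"
      then have cd: "c \<in> carrier Z" "d \<in> carrier Z" by (auto simp: K_def)
      have "h (c \<oplus>\<^bsub>Z\<^esub> d) = \<zero>\<^bsub>C\<^esub>" if "ext \<beta> h" for \<beta> h
      proof -
        have "h c = \<zero>\<^bsub>C\<^esub>" "h d = \<zero>\<^bsub>C\<^esub>" using K that by (auto simp: K_def)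
        then show ?thesis using ext_add[OF that cd] by simp
      qed
      then show "c \<oplus>\<^bsub>Z\<^esub> d \<in> K" using Z.a_closed[OF cd] by (auto simp: K_def)
    qed
    fix c x assume c: "c \<in> K" and x: "x \<in> carrier Z"
    then have cZ: "c \<in> carrier Z" by (simp add: K_def)
    have "x \<otimes>\<^bsub>Z\<^esub> c \<in> carrier Z \<and> (h (x \<otimes>\<^bsub>Z\<^esub> c) = \<zero>\<^bsub>C\<^esub>)" if h: "ext \<beta> h" for \<beta> h
    proof -
      from x have "Poly_Mapping.keys x \<subseteq> carrier A \<times> carrier B" by simp
      then show ?thesis
      proof (induction x rule: frag_induction)
        case zero
        then show ?case using ext_zero[OF h] by simp
      next
        case (one w)
        then obtain u v where w: "w = (u, v)" "u \<in> carrier A" "v \<in> carrier B" by auto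
        then have wZ: "frag_of w \<in> carrier Z" by simp
        have "ext (\<lambda>a b. \<beta> (u \<otimes>\<^bsub>A\<^esub> a) (v \<otimes>\<^bsub>B\<^esub> b)) (\<lambda>c. h (frag_of w \<otimes>\<^bsub>Z\<^esub> c))"
          unfolding ext_def
        proof (intro conjI ballI)
          show "biadditive A B C (\<lambda>a b. \<beta> (u \<otimes>\<^bsub>A\<^esub> a) (v \<otimes>\<^bsub>B\<^esub> b))"
            using h w by (simp add: ext_def biadditive_def A.r_distr B.r_distr)
          interpret h: abelian_group_hom Z C h using h by (simp add: ext_def)
          show "abelian_group_hom Z C (\<lambda>c. h (frag_of w \<otimes>\<^bsub>Z\<^esub> c))"
            by (intro abelian_group_homI Z.abelian_group_axioms C.abelian_group_axioms
                group_hom.intro group_hom_axioms.intro Z.a_group C.a_group homI)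
              (use wZ in \<open>auto simp: Z.r_distr simp del: monoid_ring_simps\<close>)
        qed (use h w in \<open>auto simp: ext_def\<close>)
        then show ?case using c wZ cZ by (auto simp: K_def simp del: monoid_ring_simps)
      next
        case (diff p q)
        then show ?case
          using ext_diff[OF h] closed_diff by (simp add: mult_monoid_ring_diff C.minus_eq del: monoid_ring_simps)
      qed
    qed
    moreover have "x \<otimes>\<^bsub>Z\<^esub> c \<in> carrier Z" using x cZ by (rule Z.m_closed)
    ultimately show "x \<otimes>\<^bsub>Z\<^esub> c \<in> K" by (auto simp: K_def)
    have "c \<otimes>\<^bsub>Z\<^esub> x \<in> carrier Z \<and> (h (c \<otimes>\<^bsub>Z\<^esub> x) = \<zero>\<^bsub>C\<^esub>)" if h: "ext \<beta> h" for \<beta> h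
    proof -
      from x have "Poly_Mapping.keys x \<subseteq> carrier A \<times> carrier B" by simp
      then show ?thesis
      proof (induction x rule: frag_induction)
        case zero
        then show ?case using ext_zero[OF h] by simp
      next
        case (one w)
        then obtain u v where w: "w = (u, v)" "u \<in> carrier A" "v \<in> carrier B" by auto
        then have wZ: "frag_of w \<in> carrier Z" by simp
        have "ext (\<lambda>a b. \<beta> (a \<otimes>\<^bsub>A\<^esub> u) (b \<otimes>\<^bsub>B\<^esub> v)) (\<lambda>c. h (c \<otimes>\<^bsub>Z\<^esub> frag_of w))"
          unfolding ext_def
        proof (intro conjI ballI)
          show "biadditive A B C (\<lambda>a b. \<beta> (a \<otimes>\<^bsub>A\<^esub> u) (b \<otimes>\<^bsub>B\<^esub> v))"
            using h w by (simp add: ext_def biadditive_def A.l_distr B.l_distr)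
          interpret h: abelian_group_hom Z C h using h by (simp add: ext_def)
          show "abelian_group_hom Z C (\<lambda>c. h (c \<otimes>\<^bsub>Z\<^esub> frag_of w))"
            by (intro abelian_group_homI Z.abelian_group_axioms C.abelian_group_axioms
                group_hom.intro group_hom_axioms.intro Z.a_group C.a_group homI)
              (use wZ in \<open>auto simp: Z.l_distr simp del: monoid_ring_simps\<close>)
        qed (use h w in \<open>auto simp: ext_def\<close>)
        then show ?case using c wZ cZ by (auto simp: K_def simp del: monoid_ring_simps)
      next
        case (diff p q)
        then show ?case
          using ext_diff[OF h] closed_diff by (simp add: mult_monoid_ring_diff C.minus_eq del: monoid_ring_simps)
      qed
    qed
    moreover have "c \<otimes>\<^bsub>Z\<^esub> x \<in> carrier Z" using cZ x by (rule Z.m_closed)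
    ultimately show "c \<otimes>\<^bsub>Z\<^esub> x \<in> K" by (auto simp: K_def)
  qed
  moreover have "bilinearity_relators A B \<subseteq> K"
  proof
    fix r assume r: "r \<in> bilinearity_relators A B"
    \<comment> \<open>Both kinds of relators are brought to the form x - y - z, together with the
      equation that every biadditive map satisfies there.\<close>
    then obtain x y z where xyz: "r = frag_of x - frag_of y - frag_of z"
      "x \<in> carrier A \<times> carrier B" "y \<in> carrier A \<times> carrier B" "z \<in> carrier A \<times> carrier B"
      and eq: "\<And>\<beta>. biadditive A B C \<beta> \<Longrightarrow>
        \<beta> (fst x) (snd x) = \<beta> (fst y) (snd y) \<oplus>\<^bsub>C\<^esub> \<beta> (fst z) (snd z)"
      unfolding bilinearity_relators_def
    proof (elim UnE CollectE exE conjE, goal_cases)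
      case (1 a a' b)
      then show ?case by (intro 1(1)[of "(a \<oplus>\<^bsub>A\<^esub> a', b)" "(a, b)" "(a', b)"]) (auto simp: biadditive_def)
    next
      case (2 a b b')
      then show ?case by (intro 2(1)[of "(a, b \<oplus>\<^bsub>B\<^esub> b')" "(a, b)" "(a, b')"]) (auto simp: biadditive_def)
    qed
    have f: "frag_of x \<in> carrier Z" "frag_of y \<in> carrier Z" "frag_of z \<in> carrier Z"
      using xyz by auto
    have "h r = \<zero>\<^bsub>C\<^esub>" if h: "ext \<beta> h" for \<beta> h
    proof -
      have \<beta>: "\<beta> (fst w) (snd w) \<in> carrier C" "h (frag_of w) = \<beta> (fst w) (snd w)"
        if "w \<in> carrier A \<times> carrier B" for w
        using h that by (auto simp: ext_def biadditive_def)
      have "h r = \<beta> (fst x) (snd x) \<ominus>\<^bsub>C\<^esub> \<beta> (fst y) (snd y) \<ominus>\<^bsub>C\<^esub> \<beta> (fst z) (snd z)"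
        using f by (simp add: xyz ext_diff[OF h] closed_diff \<beta>(2) del: monoid_ring_simps)
      also have "\<dots> = \<zero>\<^bsub>C\<^esub>"
        using \<beta>(1)[OF xyz(2)] \<beta>(1)[OF xyz(3)] \<beta>(1)[OF xyz(4)] eq[of \<beta>] h
        by (simp add: ext_def C.minus_minus_eq_zero_iff)
      finally show ?thesis .
    qed
    moreover have "r \<in> carrier Z" using r keys_relators by blast
    ultimately show "r \<in> K" by (auto simp: K_def)
  qed
  ultimately have "J \<subseteq> K"
    unfolding bilinearity_ideal_def by (rule Z.genideal_minimal)
  moreover obtain h where h: "ext \<beta> h" using ext_ex[OF \<beta>] by blast
  ultimately have "\<And>c. c \<in> J \<Longrightarrow> h c = \<zero>\<^bsub>C\<^esub>" by (auto simp: K_def)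
  moreover have "abelian_group_hom Z C h" using h by (simp add: ext_def)
  ultimately obtain g where g: "abelian_group_hom (Z Quot J) C g"
    "\<And>x. x \<in> carrier Z \<Longrightarrow> g (J +>\<^bsub>Z\<^esub> x) = h x"
    using ideal.factor_additive_hom[OF ideal_J] by blast
  show thesis
  proof (rule that)
    show "abelian_group_hom T C g" using g(1) by (simp add: tensor_ring_def)
    show "g (a \<otimes>\<^sub>T b) = \<beta> a b" if "a \<in> carrier A" "b \<in> carrier B" for a b
      using that h by (simp add: pure_tensor_def g(2) ext_def)
  qed
qed

end

section \<open>Free algebras and algebras given by generators and relations\<close>

section \<open>Presentations and the Hecke-Hopf algebra\<close>

lemma (in abelian_group_hom) hom_minus:
  assumes "x \<in> carrier G" "y \<in> carrier G"
  shows "h (x \<ominus>\<^bsub>G\<^esub> y) = h x \<ominus>\<^bsub>H\<^esub> h y"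
  using assms by (simp add: G.minus_eq H.minus_eq)

lemma (in abelian_group_hom) hom_finsum:
  assumes "finite I" "f \<in> I \<rightarrow> carrier G"
  shows "h (\<Oplus>\<^bsub>G\<^esub>i\<in>I. f i) = (\<Oplus>\<^bsub>H\<^esub>i\<in>I. h (f i))"
  using assms
proof (induction I rule: finite_induct)
  case (insert i I)
  then have "f \<in> I \<rightarrow> carrier G" "f i \<in> carrier G" by auto
  moreover from this have "(\<lambda>i. h (f i)) \<in> I \<rightarrow> carrier H" by (auto simp: Pi_iff)
  ultimately show ?case using insert by simp
qed simp

lemma monoid_free_monoid: "monoid (free_monoid X)"
  by (rule monoidI) (auto simp: free_monoid_def)

lemma ring_free_algebra: "ring (free_algebra X)"
  unfolding free_algebra_def by (rule ring_monoid_ring[OF monoid_free_monoid])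

lemma free_gen_closed: "x \<in> X \<Longrightarrow> free_gen x \<in> carrier (free_algebra X)"
  by (simp add: free_algebra_def free_gen_def free_monoid_def)

text \<open>Evaluating a word as a product in \<open>R\<close> is a monoid homomorphism, which then
  extends to the monoid ring.\<close>

lemma free_algebra_extension:
  assumes "ring R" "f \<in> X \<rightarrow> carrier R"
  obtains h where "h \<in> ring_hom (free_algebra X) R"
    "\<And>x. x \<in> X \<Longrightarrow> h (free_gen x) = f x"
proof -
  interpret R: ring R by fact
  define e where "e = (\<lambda>w. foldr (\<lambda>g x. f g \<otimes>\<^bsub>R\<^esub> x) w \<one>\<^bsub>R\<^esub>)"
  have closed: "e w \<in> carrier R" if "w \<in> lists X" for w
    using that by (induction w) (use assms(2) in \<open>auto simp: e_def\<close>)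
  have append: "e (v @ w) = e v \<otimes>\<^bsub>R\<^esub> e w" if "v \<in> lists X" "w \<in> lists X" for v w
    using that(1)
  proof (induction v)
    case Nil
    then show ?case using closed[OF that(2)] by (simp add: e_def)
  next
    case (Cons x v)
    then have "f x \<in> carrier R" using assms(2) by auto
    then show ?case
      using Cons closed[OF that(2)] closed[OF Cons.hyps(2)] by (simp add: e_def R.m_assoc)
  qed
  have "e \<in> hom (free_monoid X) R" "e \<one>\<^bsub>free_monoid X\<^esub> = \<one>\<^bsub>R\<^esub>"
    using closed append by (auto simp: hom_def free_monoid_def) (simp add: e_def)
  with monoid_ring_extension[OF monoid_free_monoid assms(1)]
  obtain h where h: "h \<in> ring_hom (free_algebra X) R"
    "\<And>w. w \<in> lists X \<Longrightarrow> h (frag_of w) = e w"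
    unfolding free_algebra_def by (metis free_monoid_def partial_object.select_convs(1))
  have "e [x] = f x" if "x \<in> X" for x
    using Pi_mem[OF assms(2) that] by (simp add: e_def)
  with h show thesis by (intro that[of h]) (auto simp: free_gen_def)
qed

text \<open>The relations are natural in the ring. Both inclusions matter: one lifts a relation of
  the quotient to the free algebra, the other carries relations of the free algebra to a target
  ring.\<close>

lemma hecke_relations_image:
  assumes "ring_hom_ring R R' \<phi>"
    and gens: "\<And>i. i \<in> {1..n-1} \<Longrightarrow> s i \<in> carrier R \<and> D i \<in> carrier R \<and> \<phi> (s i) = s' i \<and> \<phi> (D i) = D' i"
  shows "hecke_relations n R' s' D' = map_prod \<phi> \<phi> ` hecke_relations n R s D"
proof -
  interpret ring_hom_ring R R' \<phi> by fact
  have [simp]: "s i \<in> carrier R" "D i \<in> carrier R" "s' i = \<phi> (s i)" "D' i = \<phi> (D i)"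
    if "1 \<le> i" "i \<le> n - Suc 0" for i
    using gens[of i] that by auto
  show ?thesis
  proof (intro equalityI subsetI)
    fix p assume "p \<in> hecke_relations n R' s' D'"
    moreover obtain a b where "p = (a, b)" by (cases p)
    moreover have "(a, b) \<in> map_prod \<phi> \<phi> ` hecke_relations n R s D"
      if "(a, b) \<in> hecke_relations n R' s' D'"
      using that
    proof (induction rule: hecke_relations.induct)
      case (s_square i)
      then show ?case by (intro image_eqI[OF _ hecke_relations.s_square[of i]]) auto
    next
      case (s_D i)
      then show ?case by (intro image_eqI[OF _ hecke_relations.s_D[of i]]) (auto simp: R.minus_eq S.minus_eq)
    next
      case (D_square i)
      then show ?case by (intro image_eqI[OF _ hecke_relations.D_square[of i]]) auto
    next
      case (s_s_far i j)
      then show ?case by (intro image_eqI[OF _ hecke_relations.s_s_far[of i _ j]]) auto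
    next
      case (D_s_far i j)
      then show ?case by (intro image_eqI[OF _ hecke_relations.D_s_far[of i _ j]]) auto
    next
      case (D_D_far i j)
      then show ?case by (intro image_eqI[OF _ hecke_relations.D_D_far[of i _ j]]) auto
    next
      case (s_s_s i j)
      then show ?case by (intro image_eqI[OF _ hecke_relations.s_s_s[of i _ j]]) auto
    next
      case (D_s_s i j)
      then show ?case by (intro image_eqI[OF _ hecke_relations.D_s_s[of i _ j]]) auto
    next
      case (D_s_D i j)
      then show ?case by (intro image_eqI[OF _ hecke_relations.D_s_D[of i _ j]]) auto
    qed
    ultimately show "p \<in> map_prod \<phi> \<phi> ` hecke_relations n R s D" by simp
  next
    fix p assume "p \<in> map_prod \<phi> \<phi> ` hecke_relations n R s D"
    then obtain a b where p: "p = (\<phi> a, \<phi> b)" and "(a, b) \<in> hecke_relations n R s D" by auto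
    from this(2) have "(\<phi> a, \<phi> b) \<in> hecke_relations n R' s' D'"
    proof (induction rule: hecke_relations.induct)
      case (s_square i)
      then show ?case using hecke_relations.s_square[of i n R' s' D'] by simp
    next
      case (s_D i)
      then show ?case using hecke_relations.s_D[of i n R' s' D'] by (simp add: R.minus_eq S.minus_eq)
    next
      case (D_square i)
      then show ?case using hecke_relations.D_square[of i n R' D' s'] by simp
    next
      case (s_s_far i j)
      then show ?case using hecke_relations.s_s_far[of i n j R' s' D'] by simp
    next
      case (D_s_far i j)
      then show ?case using hecke_relations.D_s_far[of i n j R' D' s'] by simp
    next
      case (D_D_far i j)
      then show ?case using hecke_relations.D_D_far[of i n j R' D' s'] by simp
    next
      case (s_s_s i j)
      then show ?case using hecke_relations.s_s_s[of i n j R' s' D'] by simp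
    next
      case (D_s_s i j)
      then show ?case using hecke_relations.D_s_s[of i n j R' D' s'] by simp
    next
      case (D_s_D i j)
      then show ?case using hecke_relations.D_s_D[of i n j R' D' s'] by simp
    qed
    with p show "p \<in> hecke_relations n R' s' D'" by simp
  qed
qed

lemma hecke_relations_closed:
  assumes "ring R" "\<And>i. i \<in> {1..n-1} \<Longrightarrow> s i \<in> carrier R \<and> D i \<in> carrier R"
    "(a, b) \<in> hecke_relations n R s D"
  shows "a \<in> carrier R \<and> b \<in> carrier R"
proof -
  interpret ring R by fact
  note [simp] = assms(2)[THEN conjunct1] assms(2)[THEN conjunct2]
  from assms(3) show ?thesis
    by (induction rule: hecke_relations.induct) (simp_all del: One_nat_def atLeastAtMost_iff)
qed

definition "hecke_relators n =
  {a \<ominus>\<^bsub>hecke_free n\<^esub> b | a b.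
    (a, b) \<in> hecke_relations n (hecke_free n) (free_gen \<circ> S_gen) (free_gen \<circ> D_gen)}"

lemma free_gens_closed:
  assumes "i \<in> {1..n-1}"
  shows "free_gen (S_gen i) \<in> carrier (hecke_free n) \<and> free_gen (D_gen i) \<in> carrier (hecke_free n)"
  using assms by (auto simp: hecke_gens_def intro!: free_gen_closed)

lemma hecke_relators_closed: "hecke_relators n \<subseteq> carrier (hecke_free n)"
proof -
  interpret ring "hecke_free n" by (rule ring_free_algebra)
  show ?thesis
    using hecke_relations_closed[OF ring_axioms, of n "free_gen \<circ> S_gen" "free_gen \<circ> D_gen"]
      free_gens_closed
    by (auto simp: hecke_relators_def)
qed

lemma hecke_ideal_eq: "hecke_ideal n = Idl\<^bsub>hecke_free n\<^esub> (hecke_relators n)"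
  by (simp add: hecke_ideal_def hecke_relators_def)

lemma ideal_hecke_ideal: "ideal (hecke_ideal n) (hecke_free n)"
  unfolding hecke_ideal_eq
  by (rule ring.genideal_ideal[OF ring_free_algebra hecke_relators_closed])

lemma ring_hecke_algebra: "ring (hecke_algebra n)"
  unfolding hecke_algebra_def by (rule ideal.quotient_is_ring[OF ideal_hecke_ideal])

lemma zero_hecke_algebra: "\<zero>\<^bsub>hecke_algebra n\<^esub> = hecke_ideal n"
  by (simp add: hecke_algebra_def FactRing_def)

lemma carrier_hecke_algebra:
  "carrier (hecke_algebra n) = (+>\<^bsub>hecke_free n\<^esub>) (hecke_ideal n) ` carrier (hecke_free n)"
  by (auto simp: hecke_algebra_def FactRing_def A_RCOSETS_def')

lemma hecke_proj_hom:
  "ring_hom_ring (hecke_free n) (hecke_algebra n) ((+>\<^bsub>hecke_free n\<^esub>) (hecke_ideal n))"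
  unfolding hecke_algebra_def by (rule ideal.rcos_ring_hom_ring[OF ideal_hecke_ideal])

lemma hecke_gens_closed:
  assumes "i \<in> {1..n-1}"
  shows "hecke_s n i \<in> carrier (hecke_algebra n) \<and> hecke_D n i \<in> carrier (hecke_algebra n)"
  using free_gens_closed[OF assms] ring_hom_closed[OF ring_hom_ring.homh[OF hecke_proj_hom]]
  by (simp add: hecke_s_def hecke_D_def)

text \<open>Such a relation is the image of one in the free algebra, and there the difference of the
  two sides is a relator, hence zero in the quotient.\<close>

lemma hecke_relations_hold:
  assumes "(a, b) \<in> hecke_relations n (hecke_algebra n) (hecke_s n) (hecke_D n)"
  shows "a = b"
proof -
  interpret p: ring_hom_ring "hecke_free n" "hecke_algebra n" "(+>\<^bsub>hecke_free n\<^esub>) (hecke_ideal n)"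
    by (rule hecke_proj_hom)
  interpret I: ideal "hecke_ideal n" "hecke_free n" by (rule ideal_hecke_ideal)
  have "hecke_relations n (hecke_algebra n) (hecke_s n) (hecke_D n) =
      map_prod ((+>\<^bsub>hecke_free n\<^esub>) (hecke_ideal n)) ((+>\<^bsub>hecke_free n\<^esub>) (hecke_ideal n)) `
        hecke_relations n (hecke_free n) (free_gen \<circ> S_gen) (free_gen \<circ> D_gen)"
    using free_gens_closed
    by (intro hecke_relations_image hecke_proj_hom) (auto simp: hecke_s_def hecke_D_def)
  with assms obtain c d where cd: "(c, d) \<in> hecke_relations n (hecke_free n) (free_gen \<circ> S_gen) (free_gen \<circ> D_gen)"
    and ab: "a = hecke_ideal n +>\<^bsub>hecke_free n\<^esub> c" "b = hecke_ideal n +>\<^bsub>hecke_free n\<^esub> d"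
    by auto
  have "c \<in> carrier (hecke_free n)" "d \<in> carrier (hecke_free n)"
    using hecke_relations_closed[OF p.R.ring_axioms _ cd] free_gens_closed by auto
  moreover have "c \<ominus>\<^bsub>hecke_free n\<^esub> d \<in> hecke_relators n"
    using cd by (auto simp: hecke_relators_def)
  then have "c \<ominus>\<^bsub>hecke_free n\<^esub> d \<in> hecke_ideal n"
    using p.R.genideal_self[OF hecke_relators_closed] by (auto simp: hecke_ideal_eq)
  from I.a_rcos_const[OF this]
  have "hecke_ideal n +>\<^bsub>hecke_free n\<^esub> (c \<ominus>\<^bsub>hecke_free n\<^esub> d) = \<zero>\<^bsub>hecke_algebra n\<^esub>"
    unfolding zero_hecke_algebra .
  ultimately show ?thesis
    by (simp add: ab p.hom_minus p.S.minus_eq_zero_iff)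
qed

text \<open>Universal property of the presentation: the kernel of the evaluation map on the free
  algebra is an ideal containing the relators, hence contains \<open>hecke_ideal n\<close>. It
  produces the coproduct, the counit and the action.\<close>

lemma hecke_algebra_extension:
  assumes "ring R" and closed: "\<And>i. i \<in> {1..n-1} \<Longrightarrow> s i \<in> carrier R \<and> D i \<in> carrier R"
    and rel: "\<And>a b. (a, b) \<in> hecke_relations n R s D \<Longrightarrow> a = b"
  obtains \<phi> where "\<phi> \<in> ring_hom (hecke_algebra n) R"
    "\<And>i. i \<in> {1..n-1} \<Longrightarrow> \<phi> (hecke_s n i) = s i \<and> \<phi> (hecke_D n i) = D i"
proof -
  interpret R: ring R by fact
  interpret F: ring "hecke_free n" by (rule ring_free_algebra)
  have "case_hecke_gen s D \<in> hecke_gens n \<rightarrow> carrier R"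
    using closed by (auto simp: hecke_gens_def)
  then obtain h where h: "h \<in> ring_hom (hecke_free n) R"
    and gen: "\<And>x. x \<in> hecke_gens n \<Longrightarrow> h (free_gen x) = case_hecke_gen s D x"
    using free_algebra_extension[OF assms(1)] by blast
  interpret h: ring_hom_ring "hecke_free n" R h
    by (intro ring_hom_ringI2 F.ring_axioms assms(1) h)
  have gens: "h (free_gen (S_gen i)) = s i \<and> h (free_gen (D_gen i)) = D i" if "i \<in> {1..n-1}" for i
    using gen[of "S_gen i"] gen[of "D_gen i"] that by (auto simp: hecke_gens_def)
  have image: "hecke_relations n R s D =
      map_prod h h ` hecke_relations n (hecke_free n) (free_gen \<circ> S_gen) (free_gen \<circ> D_gen)"
    by (intro hecke_relations_image h.ring_hom_ring_axioms) (simp del: One_nat_def atLeastAtMost_iff add: gens free_gens_closed)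
  have "h r = \<zero>\<^bsub>R\<^esub>" if "r \<in> hecke_relators n" for r
  proof -
    from that obtain a b where r: "r = a \<ominus>\<^bsub>hecke_free n\<^esub> b"
      and ab: "(a, b) \<in> hecke_relations n (hecke_free n) (free_gen \<circ> S_gen) (free_gen \<circ> D_gen)"
      by (auto simp: hecke_relators_def)
    have closed: "a \<in> carrier (hecke_free n)" "b \<in> carrier (hecke_free n)"
      using hecke_relations_closed[OF F.ring_axioms _ ab] free_gens_closed by auto
    have "h a = h b" using ab image by (intro rel) force
    with closed show ?thesis by (simp add: r h.hom_minus R.minus_eq R.r_neg)
  qed
  then have "hecke_relators n \<subseteq> a_kernel (hecke_free n) R h"
    unfolding a_kernel_def' using hecke_relators_closed by blast
  then have "hecke_ideal n \<subseteq> a_kernel (hecke_free n) R h"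
    unfolding hecke_ideal_eq by (rule F.genideal_minimal[OF h.kernel_is_ideal])
  then have "\<And>a. a \<in> hecke_ideal n \<Longrightarrow> h a = \<zero>\<^bsub>R\<^esub>" unfolding a_kernel_def' by blast
  then obtain g where g: "g \<in> ring_hom (hecke_algebra n) R"
    "\<And>x. x \<in> carrier (hecke_free n) \<Longrightarrow> g (hecke_ideal n +>\<^bsub>hecke_free n\<^esub> x) = h x"
    using ideal.factor_ring_hom[OF ideal_hecke_ideal assms(1) h] by (auto simp: hecke_algebra_def)
  show thesis
    using that[OF g(1)] g(2) free_gens_closed gens by (simp add: hecke_s_def hecke_D_def)
qed

text \<open>Every element is the class of an integer combination of words, and words are products of
  generators; so a property defining a subring holds everywhere once it holds on generators.\<close>

lemma hecke_algebra_induct [consumes 1, case_names one s D mult diff]: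
  assumes "x \<in> carrier (hecke_algebra n)"
    and one: "P \<one>\<^bsub>hecke_algebra n\<^esub>"
    and s: "\<And>i. i \<in> {1..n-1} \<Longrightarrow> P (hecke_s n i)"
    and D: "\<And>i. i \<in> {1..n-1} \<Longrightarrow> P (hecke_D n i)"
    and mult: "\<And>x y. x \<in> carrier (hecke_algebra n) \<Longrightarrow> y \<in> carrier (hecke_algebra n) \<Longrightarrow>
      P x \<Longrightarrow> P y \<Longrightarrow> P (x \<otimes>\<^bsub>hecke_algebra n\<^esub> y)"
    and diff: "\<And>x y. x \<in> carrier (hecke_algebra n) \<Longrightarrow> y \<in> carrier (hecke_algebra n) \<Longrightarrow>
      P x \<Longrightarrow> P y \<Longrightarrow> P (x \<ominus>\<^bsub>hecke_algebra n\<^esub> y)"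
  shows "P x"
proof -
  interpret p: ring_hom_ring "hecke_free n" "hecke_algebra n" "(+>\<^bsub>hecke_free n\<^esub>) (hecke_ideal n)"
    by (rule hecke_proj_hom)
  let ?p = "(+>\<^bsub>hecke_free n\<^esub>) (hecke_ideal n)"
  have frag: "frag_of w \<in> carrier (hecke_free n)" if "w \<in> lists (hecke_gens n)" for w
    using that by (simp add: free_algebra_def free_monoid_def)
  have word: "P (?p (frag_of w))" if "w \<in> lists (hecke_gens n)" for w
    using that
  proof (induction w)
    case Nil
    then show ?case
      using one p.hom_one by (simp add: free_algebra_def free_monoid_def)
  next
    case (Cons g w)
    then have g: "free_gen g \<in> carrier (hecke_free n)" by (intro free_gen_closed)
    from Cons have w: "frag_of w \<in> carrier (hecke_free n)" by (intro frag) auto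
    have "frag_of (g # w) = free_gen g \<otimes>\<^bsub>hecke_free n\<^esub> frag_of w"
      by (simp add: free_algebra_def free_gen_def free_monoid_def)
    moreover have "P (?p (free_gen g))"
      using Cons s D by (auto simp: hecke_gens_def hecke_s_def hecke_D_def)
    ultimately show ?case using Cons.IH mult[OF p.hom_closed[OF g] p.hom_closed[OF w]] g w
      by simp
  qed
  \<comment> \<open>Zero arises as the difference of the unit with itself.\<close>
  have zero: "P \<zero>\<^bsub>hecke_algebra n\<^esub>"
    using diff[OF p.S.one_closed p.S.one_closed one one]
    unfolding p.S.minus_eq_zero_iff[OF p.S.one_closed p.S.one_closed, THEN iffD2, OF refl] .
  obtain c where c: "c \<in> carrier (hecke_free n)" "x = ?p c"
    using assms(1) unfolding carrier_hecke_algebra by blast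
  then have "Poly_Mapping.keys c \<subseteq> lists (hecke_gens n)"
    by (simp add: free_algebra_def free_monoid_def)
  then have "c \<in> carrier (hecke_free n) \<and> P (?p c)"
  proof (induction c rule: frag_induction)
    case zero
    then show ?case using \<open>P \<zero>\<^bsub>_\<^esub>\<close> p.hom_zero by (simp add: free_algebra_def)
  next
    case (one w)
    then show ?case using word frag by blast
  next
    case (diff a b)
    then have ab: "a \<in> carrier (hecke_free n)" "b \<in> carrier (hecke_free n)" by auto
    moreover have "a - b = a \<ominus>\<^bsub>hecke_free n\<^esub> b"
      using minus_monoid_ring[OF monoid_free_monoid] ab unfolding free_algebra_def by metis
    ultimately show ?case
      using diff assms(6)[OF p.hom_closed[OF ab(1)] p.hom_closed[OF ab(2)]] by (simp add: p.hom_minus)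
  qed
  with c show ?thesis by simp
qed

section \<open>Compatibility of coproduct and counit with the defining relations\<close>

section \<open>The coproduct and the counit\<close>

context tensor_product
begin

lemma tensor_minus_left:
  assumes "a \<in> carrier A" "a' \<in> carrier A" "b \<in> carrier B"
  shows "(a \<ominus>\<^bsub>A\<^esub> a') \<otimes>\<^sub>T b = a \<otimes>\<^sub>T b \<ominus>\<^bsub>T\<^esub> a' \<otimes>\<^sub>T b"
proof -
  interpret T: ring T by (rule ring_T)
  have "a \<otimes>\<^sub>T b = (a \<ominus>\<^bsub>A\<^esub> a') \<otimes>\<^sub>T b \<oplus>\<^bsub>T\<^esub> a' \<otimes>\<^sub>T b"
    using assms by (simp flip: tensor_add_left add: A.minus_eq A.a_assoc A.l_neg)
  then show ?thesis
    using assms by (simp add: T.minus_eq T.add.inv_solve_right)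
qed

lemma tensor_minus_right:
  assumes "a \<in> carrier A" "b \<in> carrier B" "b' \<in> carrier B"
  shows "a \<otimes>\<^sub>T (b \<ominus>\<^bsub>B\<^esub> b') = a \<otimes>\<^sub>T b \<ominus>\<^bsub>T\<^esub> a \<otimes>\<^sub>T b'"
proof -
  interpret T: ring T by (rule ring_T)
  have "a \<otimes>\<^sub>T b = a \<otimes>\<^sub>T (b \<ominus>\<^bsub>B\<^esub> b') \<oplus>\<^bsub>T\<^esub> a \<otimes>\<^sub>T b'"
    using assms by (simp flip: tensor_add_right add: B.minus_eq B.a_assoc B.l_neg)
  then show ?thesis
    using assms by (simp add: T.minus_eq T.add.inv_solve_right)
qed

end

text \<open>This is what makes the coproduct well defined. The products are multiplied out, and the
  relations of \<open>R\<close> are applied in the separate tensor factors.\<close>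

lemma hecke_relations_tensor:
  fixes R :: "('a, 'm) ring_scheme"
  assumes "ring R" and closed: "\<And>i. i \<in> {1..n-1} \<Longrightarrow> s i \<in> carrier R \<and> D i \<in> carrier R"
    and rel: "\<And>a b. (a, b) \<in> hecke_relations n R s D \<Longrightarrow> a = b"
    and "(a, b) \<in> hecke_relations n (tensor_ring R R) (\<lambda>i. pure_tensor R R (s i) (s i))
      (\<lambda>i. pure_tensor R R (D i) \<one>\<^bsub>R\<^esub> \<oplus>\<^bsub>tensor_ring R R\<^esub> pure_tensor R R (s i) (D i))"
  shows "a = b"
proof -
  interpret R: ring R by fact
  interpret tensor_product R R ..
  interpret T: ring T by (rule ring_T)
  let ?t = "pure_tensor R R" and ?T = "tensor_ring R R"
  note cl = closed[THEN conjunct1] closed[THEN conjunct2]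
  note ss = hecke_relations.s_square[of _ n R s D, THEN rel]
    and sD = hecke_relations.s_D[of _ n R s D, THEN rel]
    and DD = hecke_relations.D_square[of _ n R D s, THEN rel]
    and ssf = hecke_relations.s_s_far[of _ n _ R s D, THEN rel]
    and Dsf = hecke_relations.D_s_far[of _ n _ R D s, THEN rel]
    and DDf = hecke_relations.D_D_far[of _ n _ R D s, THEN rel]
    and sss = hecke_relations.s_s_s[of _ n _ R s D, THEN rel]
    and Dss = hecke_relations.D_s_s[of _ n _ R D s, THEN rel]
    and DsD = hecke_relations.D_s_D[of _ n _ R D s, THEN rel]
  \<comment> \<open>The form without subtraction can contract or expand sums under rewriting modulo
    commutativity.\<close>
  have sD': "s i \<otimes>\<^bsub>R\<^esub> D i \<oplus>\<^bsub>R\<^esub> D i \<otimes>\<^bsub>R\<^esub> s i \<oplus>\<^bsub>R\<^esub> \<one>\<^bsub>R\<^esub> = s i" if "i \<in> {1..n-1}" for i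
    using sD[OF that] cl[OF that] by (simp add: R.minus_eq R.a_assoc R.l_neg)
  from assms(4) show ?thesis
  proof (induction rule: hecke_relations.induct)
    case (s_square i)
    then show ?case by (simp add: cl ss tensor_one del: atLeastAtMost_iff)
  next
    case (s_D i)
    note [simp] = cl[OF s_D]
    let ?s = "s i" and ?D = "D i" and ?e = "\<one>\<^bsub>R\<^esub>"
    \<comment> \<open>Since s^2 = 1, each product has one term with s in the second factor and one
      with 1 in the first. After sD + Ds is replaced by s - 1, the two copies of 1 \<otimes> s
      cancel.\<close>
    have "?t ?s ?s \<otimes>\<^bsub>?T\<^esub> (?t ?D ?e \<oplus>\<^bsub>?T\<^esub> ?t ?s ?D) \<oplus>\<^bsub>?T\<^esub> (?t ?D ?e \<oplus>\<^bsub>?T\<^esub> ?t ?s ?D) \<otimes>\<^bsub>?T\<^esub> ?t ?s ?s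
      = ?t (?s \<otimes>\<^bsub>R\<^esub> ?D \<oplus>\<^bsub>R\<^esub> ?D \<otimes>\<^bsub>R\<^esub> ?s) ?s \<oplus>\<^bsub>?T\<^esub> ?t ?e (?s \<otimes>\<^bsub>R\<^esub> ?D \<oplus>\<^bsub>R\<^esub> ?D \<otimes>\<^bsub>R\<^esub> ?s)"
      by (simp add: T.l_distr T.r_distr tensor_add_left tensor_add_right ss[OF s_D] T.a_ac)
    also have "\<dots> = ?t (?s \<ominus>\<^bsub>R\<^esub> ?e) ?s \<oplus>\<^bsub>?T\<^esub> ?t ?e (?s \<ominus>\<^bsub>R\<^esub> ?e)"
      by (simp only: sD[OF s_D])
    also have "\<dots> = ?t ?s ?s \<ominus>\<^bsub>?T\<^esub> \<one>\<^bsub>?T\<^esub>"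
      by (simp add: tensor_minus_left tensor_minus_right T.minus_eq T.a_assoc T.r_neg1 T.r_neg2 tensor_one)
    finally show ?case .
  next
    case (D_square i)
    note [simp] = cl[OF D_square]
    let ?s = "s i" and ?D = "D i" and ?e = "\<one>\<^bsub>R\<^esub>"
    \<comment> \<open>The mixed terms sD \<otimes> D and Ds \<otimes> D join the square of s
      \<otimes> D, which is 1 \<otimes> D; their sum is s \<otimes> D by \<open>sD'\<close>.\<close>
    have "(?t ?D ?e \<oplus>\<^bsub>?T\<^esub> ?t ?s ?D) \<otimes>\<^bsub>?T\<^esub> (?t ?D ?e \<oplus>\<^bsub>?T\<^esub> ?t ?s ?D)
      = ?t ?D ?e \<oplus>\<^bsub>?T\<^esub> ?t (?s \<otimes>\<^bsub>R\<^esub> ?D \<oplus>\<^bsub>R\<^esub> ?D \<otimes>\<^bsub>R\<^esub> ?s \<oplus>\<^bsub>R\<^esub> ?e) ?D"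
      by (simp add: T.l_distr T.r_distr tensor_add_left ss[OF D_square] DD[OF D_square] T.a_ac)
    then show ?case by (simp only: sD'[OF D_square])
  next
    case (s_s_far i j)
    then show ?case by (simp add: cl ssf[of i j] del: atLeastAtMost_iff)
  next
    case (D_s_far i j)
    note [simp] = cl[OF D_s_far(1)] cl[OF D_s_far(2)]
    show ?case by (simp add: T.l_distr T.r_distr ssf[OF D_s_far] Dsf[OF D_s_far])
  next
    case (D_D_far i j)
    note [simp] = cl[OF D_D_far(1)] cl[OF D_D_far(2)]
    have "\<bar>int j - int i\<bar> > 1" using D_D_far(3) by simp
    note ji = D_D_far(2,1) this
    show ?case
      by (simp add: T.l_distr T.r_distr ssf[OF D_D_far] Dsf[OF D_D_far] DDf[OF D_D_far] Dsf[OF ji] T.a_ac)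
  next
    case (s_s_s i j)
    then show ?case by (simp add: cl sss[of i j] del: atLeastAtMost_iff)
  next
    case (D_s_s i j)
    note [simp] = cl[OF D_s_s(1)] cl[OF D_s_s(2)]
    show ?case by (simp add: T.l_distr T.r_distr sss[OF D_s_s] Dss[OF D_s_s])
  next
    case (D_s_D i j)
    note [simp] = cl[OF D_s_D(1)] cl[OF D_s_D(2)]
    have "\<bar>int j - int i\<bar> = 1" using D_s_D(3) by simp
    note ji = D_s_D(2,1) this
    let ?X = "s i \<otimes>\<^bsub>R\<^esub> (D j \<otimes>\<^bsub>R\<^esub> s i)"
    \<comment> \<open>With X = s_i D_j s_i, the left side leaves X \<otimes> s_i, whereas the right
      side contains X \<otimes> (s_i D_i + D_i s_i + 1). All other terms match by the relations in
      single factors.\<close>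
    have X: "?t ?X (s i) = ?t ?X (s i \<otimes>\<^bsub>R\<^esub> D i) \<oplus>\<^bsub>?T\<^esub> (?t ?X (D i \<otimes>\<^bsub>R\<^esub> s i) \<oplus>\<^bsub>?T\<^esub> ?t ?X \<one>\<^bsub>R\<^esub>)"
      by (subst sD'[OF D_s_D(1), symmetric]) (simp add: tensor_add_right T.a_assoc)
    note assoc = sss[OF D_s_D] Dss[OF D_s_D] Dss[OF ji] DsD[OF D_s_D]
    show ?case
      using assoc
      by (simp add: T.l_distr T.r_distr tensor_add_left tensor_add_right R.m_assoc ss[OF D_s_D(1)] X T.a_ac)
  qed
qed

lemma hecke_coproduct:
  fixes n :: nat
  defines "H \<equiv> hecke_algebra n"
  defines "T \<equiv> tensor_ring H H"
  shows "hecke_coproduct n \<in> ring_hom H T" (is ?hom)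
    and "i \<in> {1..n-1} \<Longrightarrow>
      hecke_coproduct n (hecke_s n i) = pure_tensor H H (hecke_s n i) (hecke_s n i) \<and>
      hecke_coproduct n (hecke_D n i) =
        pure_tensor H H (hecke_D n i) \<one>\<^bsub>H\<^esub> \<oplus>\<^bsub>T\<^esub> pure_tensor H H (hecke_s n i) (hecke_D n i)"
proof -
  interpret H: ring H unfolding H_def by (rule ring_hecke_algebra)
  interpret tensor_product H H ..
  interpret T: ring "tensor_ring H H" by (rule ring_T)
  note closed = hecke_gens_closed[of _ n, folded H_def]
  obtain \<Delta> where "\<Delta> \<in> ring_hom H (tensor_ring H H)"
    "\<And>i. i \<in> {1..n-1} \<Longrightarrow> \<Delta> (hecke_s n i) = pure_tensor H H (hecke_s n i) (hecke_s n i) \<and>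
      \<Delta> (hecke_D n i) =
        pure_tensor H H (hecke_D n i) \<one>\<^bsub>H\<^esub> \<oplus>\<^bsub>tensor_ring H H\<^esub> pure_tensor H H (hecke_s n i) (hecke_D n i)"
    unfolding H_def
  proof (rule hecke_algebra_extension[OF ring_T[unfolded H_def]])
    fix a b
    assume ab: "(a, b) \<in> hecke_relations n (tensor_ring (hecke_algebra n) (hecke_algebra n))
      (\<lambda>i. pure_tensor (hecke_algebra n) (hecke_algebra n) (hecke_s n i) (hecke_s n i))
      (\<lambda>i. pure_tensor (hecke_algebra n) (hecke_algebra n) (hecke_D n i) \<one>\<^bsub>hecke_algebra n\<^esub>
        \<oplus>\<^bsub>tensor_ring (hecke_algebra n) (hecke_algebra n)\<^esub>
        pure_tensor (hecke_algebra n) (hecke_algebra n) (hecke_s n i) (hecke_D n i))"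
    show "a = b"
      by (rule hecke_relations_tensor[OF ring_hecke_algebra _ _ ab])
        (rule hecke_gens_closed hecke_relations_hold, assumption)+
  qed (use closed in \<open>auto simp: H_def[symmetric] simp del: atLeastAtMost_iff\<close>)
  then have "\<exists>\<Delta>. \<Delta> \<in> ring_hom H (tensor_ring H H) \<and> (\<forall>i\<in>{1..n-1}.
      \<Delta> (hecke_s n i) = pure_tensor H H (hecke_s n i) (hecke_s n i) \<and>
      \<Delta> (hecke_D n i) =
        pure_tensor H H (hecke_D n i) \<one>\<^bsub>H\<^esub> \<oplus>\<^bsub>tensor_ring H H\<^esub> pure_tensor H H (hecke_s n i) (hecke_D n i))"
    by blast
  from someI_ex[OF this] show ?hom
    and "i \<in> {1..n-1} \<Longrightarrow>
      hecke_coproduct n (hecke_s n i) = pure_tensor H H (hecke_s n i) (hecke_s n i) \<and>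
      hecke_coproduct n (hecke_D n i) =
        pure_tensor H H (hecke_D n i) \<one>\<^bsub>H\<^esub> \<oplus>\<^bsub>T\<^esub> pure_tensor H H (hecke_s n i) (hecke_D n i)"
    unfolding hecke_coproduct_def Let_def H_def[symmetric] T_def by blast+
qed

lemma hecke_counit:
  shows "hecke_counit n \<in> ring_hom (hecke_algebra n) \<Z>" (is ?hom)
    and "i \<in> {1..n-1} \<Longrightarrow> hecke_counit n (hecke_s n i) = 1 \<and> hecke_counit n (hecke_D n i) = 0"
proof -
  \<comment> \<open>Relations involving \<open>D\<close> read 0 = 0, the one with s - 1 being 0 = 1
    - 1; those in \<open>s\<close> alone read 1 = 1.\<close>
  have "a = b" if "(a, b) \<in> hecke_relations n \<Z> (\<lambda>_. 1) (\<lambda>_. 0)" for a b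
    using that by (induction rule: hecke_relations.induct) (simp_all add: int_a_minus_eq)
  then obtain \<epsilon> where "\<epsilon> \<in> ring_hom (hecke_algebra n) \<Z>"
    "\<And>i. i \<in> {1..n-1} \<Longrightarrow> \<epsilon> (hecke_s n i) = 1 \<and> \<epsilon> (hecke_D n i) = 0"
    using hecke_algebra_extension[of \<Z> n "\<lambda>_. 1" "\<lambda>_. 0"] int.ring_axioms by auto
  then have "\<exists>\<epsilon>. \<epsilon> \<in> ring_hom (hecke_algebra n) \<Z> \<and>
    (\<forall>i\<in>{1..n-1}. \<epsilon> (hecke_s n i) = 1 \<and> \<epsilon> (hecke_D n i) = 0)" by blast
  from someI_ex[OF this] show ?hom
    and "i \<in> {1..n-1} \<Longrightarrow> hecke_counit n (hecke_s n i) = 1 \<and> hecke_counit n (hecke_D n i) = 0"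
    unfolding hecke_counit_def by blast+
qed

section \<open>Reduction of the module algebra laws to the generators\<close>

section \<open>Module algebras over the Hecke-Hopf algebra\<close>

context left_module
begin

lemma smult_hom_right:
  assumes "a \<in> carrier R"
  shows "abelian_group_hom M M (\<lambda>x. a \<odot>\<^bsub>M\<^esub> x)"
  using assms
  by (intro abelian_group_homI group_hom.intro group_hom_axioms.intro homI)
    (auto simp: smult_r_distr smult_closed M.abelian_group_axioms M.a_group)

lemma smult_hom_left:
  assumes "x \<in> carrier M"
  shows "abelian_group_hom R M (\<lambda>a. a \<odot>\<^bsub>M\<^esub> x)"
  using assms
  by (intro abelian_group_homI group_hom.intro group_hom_axioms.intro homI)
    (auto simp: smult_l_distr smult_closed M.abelian_group_axioms M.a_group
      R.abelian_group_axioms R.a_group)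

end

text \<open>The hypotheses are the two module algebra laws, read on the generators with the
  prescribed values of coproduct and counit.\<close>

lemma hecke_module_algebraI:
  fixes n :: nat and M :: "(hecke_elem, 'a) module"
  defines "H \<equiv> hecke_algebra n"
  assumes module: "left_module H M" and ring: "ring M"
    and s_mult: "\<And>i x y. \<lbrakk>i \<in> {1..n-1}; x \<in> carrier M; y \<in> carrier M\<rbrakk> \<Longrightarrow>
      hecke_s n i \<odot>\<^bsub>M\<^esub> (x \<otimes>\<^bsub>M\<^esub> y) = (hecke_s n i \<odot>\<^bsub>M\<^esub> x) \<otimes>\<^bsub>M\<^esub> (hecke_s n i \<odot>\<^bsub>M\<^esub> y)"
    and D_mult: "\<And>i x y. \<lbrakk>i \<in> {1..n-1}; x \<in> carrier M; y \<in> carrier M\<rbrakk> \<Longrightarrow>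
      hecke_D n i \<odot>\<^bsub>M\<^esub> (x \<otimes>\<^bsub>M\<^esub> y) =
        (hecke_D n i \<odot>\<^bsub>M\<^esub> x) \<otimes>\<^bsub>M\<^esub> y \<oplus>\<^bsub>M\<^esub> (hecke_s n i \<odot>\<^bsub>M\<^esub> x) \<otimes>\<^bsub>M\<^esub> (hecke_D n i \<odot>\<^bsub>M\<^esub> y)"
    and s_one: "\<And>i. i \<in> {1..n-1} \<Longrightarrow> hecke_s n i \<odot>\<^bsub>M\<^esub> \<one>\<^bsub>M\<^esub> = \<one>\<^bsub>M\<^esub>"
    and D_one: "\<And>i. i \<in> {1..n-1} \<Longrightarrow> hecke_D n i \<odot>\<^bsub>M\<^esub> \<one>\<^bsub>M\<^esub> = \<zero>\<^bsub>M\<^esub>"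
  shows "module_algebra H M (hecke_coproduct n) (hecke_counit n)"
proof -
  interpret M: ring M by (rule ring)
  interpret L: left_module H M by (rule module)
  interpret tensor_product H H ..
  let ?T = "tensor_ring H H" and ?t = "pure_tensor H H"
  let ?\<Delta> = "hecke_coproduct n" and ?\<epsilon> = "hecke_counit n"
  interpret T: ring ?T by (rule ring_T)
  interpret \<Delta>: ring_hom_ring H ?T ?\<Delta>
    by (intro ring_hom_ringI2 L.R.ring_axioms T.ring_axioms)
      (use hecke_coproduct(1)[of n] in \<open>simp add: H_def\<close>)
  interpret \<epsilon>: ring_hom_ring H \<Z> ?\<epsilon>
    by (intro ring_hom_ringI2 L.R.ring_axioms int.ring_axioms)
      (use hecke_counit(1)[of n] in \<open>simp add: H_def\<close>)
  note \<Delta>_gen = hecke_coproduct(2)[of _ n, folded H_def]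
  note closed = hecke_gens_closed[of _ n, folded H_def]
  note [simp] = L.smult_closed
  define \<beta> where "\<beta> x y u v = (u \<odot>\<^bsub>M\<^esub> x) \<otimes>\<^bsub>M\<^esub> (v \<odot>\<^bsub>M\<^esub> y)" for x y u v
  \<comment> \<open>For fixed x and y the expression is biadditive in u and v. The maps are needed
    for all x and y at once, because products of algebra elements shift the arguments to u x and v
    y.\<close>
  have "\<exists>g. abelian_group_hom ?T M g \<and> (\<forall>u\<in>carrier H. \<forall>v\<in>carrier H. g (?t u v) = \<beta> x y u v)"
    if "x \<in> carrier M" "y \<in> carrier M" for x y
  proof -
    have "biadditive H H M (\<beta> x y)"
      using that by (simp add: biadditive_def \<beta>_def L.smult_l_distr M.l_distr M.r_distr)
    then show ?thesis using biadditive_extension[OF M.abelian_group_axioms] by metis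
  qed
  then obtain \<Phi> where \<Phi>: "\<And>x y. x \<in> carrier M \<Longrightarrow> y \<in> carrier M \<Longrightarrow> abelian_group_hom ?T M (\<Phi> x y)"
    and \<Phi>_tensor: "\<And>x y u v. \<lbrakk>x \<in> carrier M; y \<in> carrier M; u \<in> carrier H; v \<in> carrier H\<rbrakk> \<Longrightarrow>
      \<Phi> x y (?t u v) = \<beta> x y u v"
    by metis
  have key: "\<forall>x\<in>carrier M. \<forall>y\<in>carrier M. h \<odot>\<^bsub>M\<^esub> (x \<otimes>\<^bsub>M\<^esub> y) = \<Phi> x y (?\<Delta> h)" if "h \<in> carrier H" for h
    using that unfolding H_def
  proof (induction h rule: hecke_algebra_induct)
    case one
    have "?\<Delta> \<one>\<^bsub>H\<^esub> = ?t \<one>\<^bsub>H\<^esub> \<one>\<^bsub>H\<^esub>" by (simp add: tensor_one)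
    then show ?case by (simp add: \<Phi>_tensor \<beta>_def L.smult_one flip: H_def)
  next
    case (s i)
    then show ?case
      by (simp add: \<Delta>_gen \<Phi>_tensor \<beta>_def s_mult closed del: atLeastAtMost_iff)
  next
    case (D i)
    show ?case
    proof (intro ballI)
      fix x y assume xy: "x \<in> carrier M" "y \<in> carrier M"
      interpret abelian_group_hom ?T M "\<Phi> x y" using xy by (rule \<Phi>)
      show "hecke_D n i \<odot>\<^bsub>M\<^esub> (x \<otimes>\<^bsub>M\<^esub> y) = \<Phi> x y (?\<Delta> (hecke_D n i))"
        using xy D closed[OF D] by (simp add: \<Delta>_gen \<Phi>_tensor \<beta>_def D_mult L.smult_one del: atLeastAtMost_iff)
    qed
  next
    case (mult h k)
    note h = mult(1)[folded H_def] and k = mult(2)[folded H_def]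
    \<comment> \<open>Every \<open>t\<close> satisfies \<open>\<Phi> x y (t (u \<otimes> v)) = \<Phi> (u x) (v y) t\<close>, so the induction hypothesis for \<open>h\<close>
      turns right multiplication by \<open>u \<otimes> v\<close> into the action of \<open>h\<close>.\<close>
    have \<Phi>_mult: "\<Phi> x y (t \<otimes>\<^bsub>?T\<^esub> ?t u v) = \<Phi> (u \<odot>\<^bsub>M\<^esub> x) (v \<odot>\<^bsub>M\<^esub> y) t"
      if "t \<in> carrier ?T" and xy: "x \<in> carrier M" "y \<in> carrier M" "u \<in> carrier H" "v \<in> carrier H" for t x y u v
    proof -
      interpret a: abelian_group_hom ?T M "\<Phi> x y" using xy by (intro \<Phi>)
      interpret b: abelian_group_hom ?T M "\<Phi> (u \<odot>\<^bsub>M\<^esub> x) (v \<odot>\<^bsub>M\<^esub> y)" using xy by (intro \<Phi>) auto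
      have uv: "?t u v \<in> carrier ?T" using xy by simp
      from that(1) show ?thesis
      proof (induction t rule: tensor_induct)
        case zero
        then show ?case using uv a.hom_zero b.hom_zero by simp
      next
        case (tensor p q)
        then show ?case using xy by (simp add: \<Phi>_tensor \<beta>_def L.smult_assoc)
      next
        case (diff t t')
        have "(t \<ominus>\<^bsub>?T\<^esub> t') \<otimes>\<^bsub>?T\<^esub> ?t u v = t \<otimes>\<^bsub>?T\<^esub> ?t u v \<ominus>\<^bsub>?T\<^esub> t' \<otimes>\<^bsub>?T\<^esub> ?t u v"
          using diff uv by (simp add: T.minus_eq T.l_distr T.l_minus)
        then show ?case using diff uv by (simp add: a.hom_minus b.hom_minus)
      qed
    qed
    show ?case
    proof (intro ballI)
      fix x y assume xy: "x \<in> carrier M" "y \<in> carrier M"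
      interpret a: abelian_group_hom ?T M "\<Phi> x y" using xy by (rule \<Phi>)
      interpret b: abelian_group_hom M M "\<lambda>z. h \<odot>\<^bsub>M\<^esub> z" using h by (rule L.smult_hom_right)
      \<comment> \<open>Both sides are additive in t, so pure tensors suffice; the identity is used
        at t = \<Delta> k, where the hypothesis on \<open>k\<close> applies.\<close>
      have "\<Phi> x y (?\<Delta> h \<otimes>\<^bsub>?T\<^esub> t) = h \<odot>\<^bsub>M\<^esub> \<Phi> x y t" if "t \<in> carrier ?T" for t
        using that
      proof (induction t rule: tensor_induct)
        case zero
        then show ?case using h a.hom_zero b.hom_zero by simp
      next
        case (tensor u v)
        then show ?case
          using h xy mult(3) by (simp add: \<Phi>_mult) (simp add: \<Phi>_tensor \<beta>_def)
      next
        case (diff t t')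
        have "?\<Delta> h \<otimes>\<^bsub>?T\<^esub> (t \<ominus>\<^bsub>?T\<^esub> t') = ?\<Delta> h \<otimes>\<^bsub>?T\<^esub> t \<ominus>\<^bsub>?T\<^esub> ?\<Delta> h \<otimes>\<^bsub>?T\<^esub> t'"
          using diff h by (simp add: T.minus_eq T.r_distr T.r_minus)
        then show ?case using diff h by (simp add: a.hom_minus b.hom_minus)
      qed
      then have "\<Phi> x y (?\<Delta> (h \<otimes>\<^bsub>H\<^esub> k)) = h \<odot>\<^bsub>M\<^esub> (k \<odot>\<^bsub>M\<^esub> (x \<otimes>\<^bsub>M\<^esub> y))"
        using h k xy mult(4) by simp
      then show "(h \<otimes>\<^bsub>hecke_algebra n\<^esub> k) \<odot>\<^bsub>M\<^esub> (x \<otimes>\<^bsub>M\<^esub> y) = \<Phi> x y (?\<Delta> (h \<otimes>\<^bsub>hecke_algebra n\<^esub> k))"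
        using h k xy by (simp add: L.smult_assoc flip: H_def)
    qed
  next
    case (diff h k)
    note hk = diff(1,2)[folded H_def]
    show ?case
    proof (intro ballI)
      fix x y assume xy: "x \<in> carrier M" "y \<in> carrier M"
      interpret a: abelian_group_hom ?T M "\<Phi> x y" using xy by (rule \<Phi>)
      interpret b: abelian_group_hom H M "\<lambda>h. h \<odot>\<^bsub>M\<^esub> (x \<otimes>\<^bsub>M\<^esub> y)"
        using xy by (intro L.smult_hom_left) simp
      show "(h \<ominus>\<^bsub>hecke_algebra n\<^esub> k) \<odot>\<^bsub>M\<^esub> (x \<otimes>\<^bsub>M\<^esub> y) = \<Phi> x y (?\<Delta> (h \<ominus>\<^bsub>hecke_algebra n\<^esub> k))"
        using hk xy diff(3,4) by (simp add: b.hom_minus \<Delta>.hom_minus a.hom_minus flip: H_def)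
    qed
  qed
  have unit: "h \<odot>\<^bsub>M\<^esub> \<one>\<^bsub>M\<^esub> = [?\<epsilon> h] \<cdot>\<^bsub>M\<^esub> \<one>\<^bsub>M\<^esub>" if "h \<in> carrier H" for h
    using that unfolding H_def
  proof (induction h rule: hecke_algebra_induct)
    case one
    have "?\<epsilon> \<one>\<^bsub>H\<^esub> = 1" using \<epsilon>.hom_one by simp
    then show ?case using L.smult_one[of "\<one>\<^bsub>M\<^esub>"] M.add.int_pow_1[of "\<one>\<^bsub>M\<^esub>"] by (simp flip: H_def)
  next
    case (s i)
    then show ?case
      using M.add.int_pow_1[of "\<one>\<^bsub>M\<^esub>"] by (simp add: s_one hecke_counit(2) del: atLeastAtMost_iff)
  next
    case (D i)
    then show ?case
      by (simp add: D_one add_pow_def hecke_counit(2) del: atLeastAtMost_iff)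
  next
    case (mult h k)
    note hk = mult(1,2)[folded H_def]
    interpret b: abelian_group_hom M M "\<lambda>z. h \<odot>\<^bsub>M\<^esub> z" using hk(1) by (rule L.smult_hom_right)
    have "(h \<otimes>\<^bsub>H\<^esub> k) \<odot>\<^bsub>M\<^esub> \<one>\<^bsub>M\<^esub> = h \<odot>\<^bsub>M\<^esub> ([?\<epsilon> k] \<cdot>\<^bsub>M\<^esub> \<one>\<^bsub>M\<^esub>)"
      using hk mult(4) by (simp add: L.smult_assoc)
    \<comment> \<open>Acting by h is additive, hence commutes with integer multiples of the
      unit.\<close>
    also have "\<dots> = [?\<epsilon> k] \<cdot>\<^bsub>M\<^esub> ([?\<epsilon> h] \<cdot>\<^bsub>M\<^esub> \<one>\<^bsub>M\<^esub>)"
      using group_hom.hom_int_pow[OF b.a_group_hom, of "\<one>\<^bsub>M\<^esub>" "?\<epsilon> k"] mult(3)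
      by (simp add: add_pow_def)
    also have "\<dots> = [?\<epsilon> (h \<otimes>\<^bsub>H\<^esub> k)] \<cdot>\<^bsub>M\<^esub> \<one>\<^bsub>M\<^esub>"
      using hk \<epsilon>.hom_mult M.add.int_pow_pow[of "\<one>\<^bsub>M\<^esub>" "?\<epsilon> k" "?\<epsilon> h"] by (simp add: mult.commute)
    finally show ?case by (simp flip: H_def)
  next
    case (diff h k)
    note hk = diff(1,2)[folded H_def]
    interpret b: abelian_group_hom H M "\<lambda>h. h \<odot>\<^bsub>M\<^esub> \<one>\<^bsub>M\<^esub>" by (intro L.smult_hom_left) simp
    have "?\<epsilon> (h \<ominus>\<^bsub>H\<^esub> k) = ?\<epsilon> h - ?\<epsilon> k" using hk \<epsilon>.hom_minus by (simp add: int_a_minus_eq)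
    then have "[?\<epsilon> (h \<ominus>\<^bsub>H\<^esub> k)] \<cdot>\<^bsub>M\<^esub> \<one>\<^bsub>M\<^esub> = [?\<epsilon> h] \<cdot>\<^bsub>M\<^esub> \<one>\<^bsub>M\<^esub> \<ominus>\<^bsub>M\<^esub> [?\<epsilon> k] \<cdot>\<^bsub>M\<^esub> \<one>\<^bsub>M\<^esub>"
      using M.add.int_pow_diff[of "\<one>\<^bsub>M\<^esub>" "?\<epsilon> h" "?\<epsilon> k"] by (simp add: M.minus_eq)
    then show ?case using hk diff(3,4) by (simp add: b.hom_minus flip: H_def)
  qed
  show ?thesis
  proof (intro module_algebra.intro module_algebra_axioms.intro module ring unit)
    fix h x y and I :: "nat set" and u v
    assume h: "h \<in> carrier H" and xy: "x \<in> carrier M" "y \<in> carrier M" and "finite I"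
      and uv: "u \<in> I \<rightarrow> carrier H" "v \<in> I \<rightarrow> carrier H"
      and eq: "?\<Delta> h = (\<Oplus>\<^bsub>?T\<^esub>j\<in>I. ?t (u j) (v j))"
    interpret a: abelian_group_hom ?T M "\<Phi> x y" using xy by (rule \<Phi>)
    \<comment> \<open>Whatever expansion of \<Delta> h is given, the additive map \<Phi> depends
      only on its sum.\<close>
    have "h \<odot>\<^bsub>M\<^esub> (x \<otimes>\<^bsub>M\<^esub> y) = (\<Oplus>\<^bsub>M\<^esub>j\<in>I. \<Phi> x y (?t (u j) (v j)))"
      unfolding key[OF h, rule_format, OF xy] eq
      using \<open>finite I\<close> uv by (intro a.hom_finsum) (auto simp: Pi_iff)
    also have "\<dots> = (\<Oplus>\<^bsub>M\<^esub>j\<in>I. (u j \<odot>\<^bsub>M\<^esub> x) \<otimes>\<^bsub>M\<^esub> (v j \<odot>\<^bsub>M\<^esub> y))"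
      using uv xy by (intro M.finsum_cong') (auto simp: \<Phi>_tensor \<beta>_def Pi_iff)
    finally show "h \<odot>\<^bsub>M\<^esub> (x \<otimes>\<^bsub>M\<^esub> y) = (\<Oplus>\<^bsub>M\<^esub>j\<in>I. (u j \<odot>\<^bsub>M\<^esub> x) \<otimes>\<^bsub>M\<^esub> (v j \<odot>\<^bsub>M\<^esub> y))" .
  qed
qed

section \<open>Permutation and Demazure operators on integral polynomials in all variables\<close>

section \<open>Demazure operators on polynomials\<close>

lemma monomial_induct [case_names zero add_single]:
  fixes m :: "'a \<Rightarrow>\<^sub>0 nat"
  assumes zero: "P 0" and add: "\<And>i m. P m \<Longrightarrow> P (Poly_Mapping.single i 1 + m)"
  shows "P m"
proof (induction m rule: update_induct)
  case (update m a b)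
  \<comment> \<open>The induction over updates inserts a whole power of a fresh variable; it is
    split here into single factors.\<close>
  have "P (Poly_Mapping.single a c + m)" for c
  proof (induction c)
    case (Suc c)
    have "Poly_Mapping.single a (Suc c) + m
        = Poly_Mapping.single a 1 + (Poly_Mapping.single a c + m)"
      by (simp add: single_add[symmetric] add.assoc[symmetric])
    then show ?case using add[OF Suc.IH] by simp
  qed (simp add: update.IH)
  moreover have "Poly_Mapping.update a b m = Poly_Mapping.single a b + m"
    using update by (intro poly_mapping_eqI) (auto simp: lookup_update lookup_add lookup_single when_def in_keys_iff)
  ultimately show ?case by simp
qed (rule zero)

lemma Var_mult_frag_of: "Var i * frag_of m = frag_of (Poly_Mapping.single i 1 + m)"
  by (simp add: Var_def mult_single)

text \<open>Additively, polynomials form the free abelian group on the monomials, and monomials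
  arise from 1 by multiplication with variables. Operator identities thereby reduce to variables and
  to the passage to products.\<close>

lemma zpoly_induct [case_names one Var mult diff]:
  fixes p :: zpoly
  assumes one: "P 1" and Var: "\<And>k. P (Var k)"
    and mult: "\<And>p q. P p \<Longrightarrow> P q \<Longrightarrow> P (p * q)"
    and diff: "\<And>p q. P p \<Longrightarrow> P q \<Longrightarrow> P (p - q)"
  shows "P p"
proof -
  have frag: "P (frag_of m)" for m
  proof (induction m rule: monomial_induct)
    case zero
    then show ?case using one by simp
  next
    case (add_single i m)
    then show ?case using mult[OF Var[of i] add_single.IH] by (simp only: Var_mult_frag_of)
  qed
  have "P 0" using diff[OF one one] by simp
  then show ?thesis by (rule frag_induction[OF subset_UNIV _ frag diff])
qed

context
  fixes \<sigma> :: "nat \<Rightarrow> nat"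
  assumes \<sigma>: "bij \<sigma>"
begin

lemma map_key_inv: "Poly_Mapping.map_key \<sigma> (Poly_Mapping.map_key (inv_into UNIV \<sigma>) m) = (m :: nat \<Rightarrow>\<^sub>0 nat)"
proof -
  have "inv_into UNIV \<sigma> \<circ> \<sigma> = (\<lambda>x. x)" using \<sigma> by (simp add: bij_is_inj id_def)
  then show ?thesis
    using \<sigma> map_key_id[of m] by (simp add: map_key_compose bij_is_inj bij_imp_bij_inv del: inj_iff[THEN iffD1] inv_o_cancel)
qed

text \<open>\<open>map_key\<close> is precomposition only along injective maps. In
  \<open>permute_poly\<close> it occurs at two levels, and this is the injectivity for the outer
  one.\<close>

lemma inj_map_key: "inj (Poly_Mapping.map_key \<sigma> :: (nat \<Rightarrow>\<^sub>0 nat) \<Rightarrow> _)"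
proof (rule inj_on_inverseI)
  fix m :: "nat \<Rightarrow>\<^sub>0 nat"
  have "\<sigma> \<circ> inv_into UNIV \<sigma> = (\<lambda>x. x)" using \<sigma> by (auto simp: fun_eq_iff bij_is_surj surj_f_inv_f)
  then show "Poly_Mapping.map_key (inv_into UNIV \<sigma>) (Poly_Mapping.map_key \<sigma> m) = m"
    using \<sigma> by (simp add: map_key_compose bij_is_inj bij_imp_bij_inv map_key_id)
qed

text \<open>Coefficients are pulled back along composition with \<sigma>, so the exponent vector
  itself is composed with the inverse.\<close>

lemma permute_poly_frag_of:
  "permute_poly \<sigma> (frag_of m) = frag_of (Poly_Mapping.map_key (inv_into UNIV \<sigma>) m)"
  unfolding permute_poly_def
  using map_key_single[OF inj_map_key, of "Poly_Mapping.map_key (inv_into UNIV \<sigma>) m"] by (simp add: map_key_inv)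

lemma permute_poly_zero: "permute_poly \<sigma> 0 = 0"
  unfolding permute_poly_def by (rule map_key_zero[OF inj_map_key])

lemma permute_poly_add: "permute_poly \<sigma> (p + q) = permute_poly \<sigma> p + permute_poly \<sigma> q"
  unfolding permute_poly_def by (rule map_key_plus[OF inj_map_key])

lemma permute_poly_diff: "permute_poly \<sigma> (p - q) = permute_poly \<sigma> p - permute_poly \<sigma> q"
  using permute_poly_add[of "p - q" q] by simp

lemma permute_poly_one: "permute_poly \<sigma> 1 = 1"
  using permute_poly_frag_of[of 0] \<sigma> by (simp add: bij_is_inj bij_imp_bij_inv)

lemma permute_poly_mult: "permute_poly \<sigma> (p * q) = permute_poly \<sigma> p * permute_poly \<sigma> q"
proof -
  have "Poly_Mapping.keys p \<subseteq> UNIV" by simp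
  then show ?thesis
  proof (induction p rule: frag_induction)
    case (one m)
    have "Poly_Mapping.keys q \<subseteq> UNIV" by simp
    then show ?case
    proof (induction q rule: frag_induction)
      case (one m')
      then show ?case
        using \<sigma> by (simp add: mult_single permute_poly_frag_of map_key_plus bij_is_inj bij_imp_bij_inv)
    qed (simp_all add: permute_poly_zero permute_poly_diff right_diff_distrib)
  qed (simp_all add: permute_poly_zero permute_poly_diff left_diff_distrib)
qed

end

definition swap_poly :: "nat \<Rightarrow> zpoly \<Rightarrow> zpoly" where
  "swap_poly i = permute_poly (transpose i (Suc i))"

lemma swap_poly_simps [simp]:
  "swap_poly i 0 = 0" "swap_poly i 1 = 1" "swap_poly i (Var k) = Var (transpose i (Suc i) k)"
  "swap_poly i (p + q) = swap_poly i p + swap_poly i q"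
  "swap_poly i (p - q) = swap_poly i p - swap_poly i q"
  "swap_poly i (p * q) = swap_poly i p * swap_poly i q"
  by (simp_all add: swap_poly_def permute_poly_zero permute_poly_one permute_poly_Var permute_poly_add
      permute_poly_diff permute_poly_mult)

lemma swap_poly_uminus [simp]: "swap_poly i (- p) = - swap_poly i p"
  using swap_poly_simps(5)[of i 0 p] by simp

lemma swap_poly_swap_poly [simp]: "swap_poly i (swap_poly i p) = p"
  by (induction p rule: zpoly_induct) simp_all

text \<open>Clearing denominators in the Demazure formula gives an equation between polynomials; a
  solution is unique since x_{i+1} - x_i is nonzero in a domain.\<close>

definition demazure_poly :: "nat \<Rightarrow> zpoly \<Rightarrow> zpoly" where
  "demazure_poly i p = (THE q. (Var (Suc i) - Var i) * q = Var (Suc i) * (p - swap_poly i p))"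

lemma Var_eq_iff [simp]: "Var i = Var j \<longleftrightarrow> i = j"
proof
  assume "Var i = Var j"
  from arg_cong[OF this, of Poly_Mapping.keys]
  have "Poly_Mapping.single i (1 :: nat) = Poly_Mapping.single j 1" by (simp add: Var_def)
  from arg_cong[OF this, of Poly_Mapping.keys] show "i = j" by simp
qed simp

lemma Var_neq_zero: "Var i \<noteq> 0"
  by (simp add: Var_def)

text \<open>Used with d = x_{i+1} - x_i and y = x_{i+1}; the terms y sp q cancel. It serves first to
  construct solutions for products and differences, then, by uniqueness, to compute them.\<close>

lemma twisted_leibniz:
  fixes d :: "'a::comm_ring_1"
  assumes "d * p' = y * (p - sp)" "d * q' = y * (q - sq)"
  shows "d * (p' * q + sp * q') = y * (p * q - sp * sq)" "d * (p' - q') = y * (p - q - (sp - sq))"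
proof -
  have "d * (p' * q + sp * q') = (d * p') * q + sp * (d * q')" by (simp add: algebra_simps)
  then show "d * (p' * q + sp * q') = y * (p * q - sp * sq)"
    unfolding assms by (simp add: algebra_simps)
  show "d * (p' - q') = y * (p - q - (sp - sq))"
    unfolding right_diff_distrib[of d] assms by (simp add: algebra_simps)
qed

lemma demazure_poly_eqI:
  assumes "(Var (Suc i) - Var i) * q = Var (Suc i) * (p - swap_poly i p)"
  shows "demazure_poly i p = q"
  unfolding demazure_poly_def
proof (rule the_equality)
  fix r assume "(Var (Suc i) - Var i) * r = Var (Suc i) * (p - swap_poly i p)"
  with assms have "(Var (Suc i) - Var i) * r = (Var (Suc i) - Var i) * q" by simp
  then show "r = q" by (simp only: mult_cancel_left right_minus_eq Var_eq_iff) simp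
qed (rule assms)

lemma demazure_poly:
  "(Var (Suc i) - Var i) * demazure_poly i p = Var (Suc i) * (p - swap_poly i p)"
proof -
  have "\<exists>q. (Var (Suc i) - Var i) * q = Var (Suc i) * (p - swap_poly i p)"
  proof (induction p rule: zpoly_induct)
    case one
    show ?case by (intro exI[of _ 0]) simp
  next
    case (Var k)
    show ?case
      \<comment> \<open>Here p - s p is x_{i+1} - x_i, its negative, or 0, so the factor x_{i+1} -
        x_i can be cancelled.\<close>
      by (intro exI[of _ "if k = Suc i then Var (Suc i) else if k = i then - Var (Suc i) else 0"])
        (auto simp: transpose_def algebra_simps)
  next
    case (mult p q)
    then obtain p' q' where "(Var (Suc i) - Var i) * p' = Var (Suc i) * (p - swap_poly i p)"
      "(Var (Suc i) - Var i) * q' = Var (Suc i) * (q - swap_poly i q)" by blast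
    then have "(Var (Suc i) - Var i) * (p' * q + swap_poly i p * q') = Var (Suc i) * (p * q - swap_poly i (p * q))"
      unfolding swap_poly_simps by (rule twisted_leibniz)
    then show ?case by blast
  next
    case (diff p q)
    then obtain p' q' where "(Var (Suc i) - Var i) * p' = Var (Suc i) * (p - swap_poly i p)"
      "(Var (Suc i) - Var i) * q' = Var (Suc i) * (q - swap_poly i q)" by blast
    then have "(Var (Suc i) - Var i) * (p' - q') = Var (Suc i) * (p - q - swap_poly i (p - q))"
      unfolding swap_poly_simps by (rule twisted_leibniz)
    then show ?case by blast
  qed
  then obtain q where q: "(Var (Suc i) - Var i) * q = Var (Suc i) * (p - swap_poly i p)" by blast
  show ?thesis unfolding demazure_poly_eqI[OF q] by (rule q)
qed

lemma demazure_poly_simps [simp]: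
  "demazure_poly i 1 = 0"
  "demazure_poly i (Var k) = (if k = Suc i then Var (Suc i) else if k = i then - Var (Suc i) else 0)"
  "demazure_poly i (p - q) = demazure_poly i p - demazure_poly i q"
  "demazure_poly i (p * q) = demazure_poly i p * q + swap_poly i p * demazure_poly i q"
proof -
  show "demazure_poly i 1 = 0"
    by (rule demazure_poly_eqI) simp
  show "demazure_poly i (Var k) = (if k = Suc i then Var (Suc i) else if k = i then - Var (Suc i) else 0)"
    by (rule demazure_poly_eqI) (auto simp: transpose_def algebra_simps)
  note D = demazure_poly[of i p] demazure_poly[of i q]
  show "demazure_poly i (p - q) = demazure_poly i p - demazure_poly i q"
    by (rule demazure_poly_eqI) (unfold swap_poly_simps, rule twisted_leibniz[OF D])
  show "demazure_poly i (p * q) = demazure_poly i p * q + swap_poly i p * demazure_poly i q"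
    by (rule demazure_poly_eqI) (unfold swap_poly_simps, rule twisted_leibniz[OF D])
qed

lemma demazure_poly_additive [simp]:
  "demazure_poly i 0 = 0" "demazure_poly i (- p) = - demazure_poly i p"
  "demazure_poly i (p + q) = demazure_poly i p + demazure_poly i q"
proof -
  show 0: "demazure_poly i 0 = 0" using demazure_poly_simps(3)[of i 0 0] by simp
  show "demazure_poly i (- p) = - demazure_poly i p" for p
    using demazure_poly_simps(3)[of i 0 p] 0 by simp
  from this[of q] show "demazure_poly i (p + q) = demazure_poly i p + demazure_poly i q"
    using demazure_poly_simps(3)[of i p "- q"] by simp
qed

text \<open>With x = x_i and y = x_{i+1}, both y and y - x are nonzero, and 1 / (1 - x/y) = y / (y -
  x).\<close>

lemma to_fract_demazure_poly: "to_fract (demazure_poly i p) = demazure i p"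
proof -
  define x y where "x = to_fract (Var i)" and "y = to_fract (Var (Suc i))"
  have ne: "y \<noteq> 0" "y - x \<noteq> 0"
    by (simp_all add: x_def y_def Var_neq_zero Zero_fract_def eq_fract)
  have "(y - x) * to_fract (demazure_poly i p) = y * (to_fract p - to_fract (swap_poly i p))"
    using arg_cong[OF demazure_poly[of i p], of to_fract] by (simp add: x_def y_def)
  then have "to_fract (demazure_poly i p) = y * (to_fract p - to_fract (swap_poly i p)) / (y - x)"
    using ne by (simp add: eq_divide_eq mult.commute)
  also have "\<dots> = 1 / (1 - x * inverse y) * (to_fract p - to_fract (swap_poly i p))"
  proof -
    have "1 - x * inverse y = (y - x) / y" using ne by (simp add: field_simps)
    then show ?thesis by simp
  qed
  finally show ?thesis by (simp add: demazure_def swap_poly_def x_def y_def)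
qed

text \<open>A left module structure amounts to a ring homomorphism into this ring, so the universal
  property of the presentation can produce the action.\<close>

definition additive_endos :: "'a::ab_group_add itself \<Rightarrow> ('a \<Rightarrow> 'a) ring" where
  "additive_endos _ = \<lparr>carrier = {f. \<forall>x y. f (x + y) = f x + f y}, mult = (\<circ>), one = id,
    ring.zero = (\<lambda>_. 0), add = (\<lambda>f g x. f x + g x)\<rparr>"

lemma ring_additive_endos: "ring (additive_endos TYPE('a::ab_group_add))"
proof (rule ringI)
  show "abelian_group (additive_endos TYPE('a))"
  proof (rule abelian_groupI)
    fix f assume f: "f \<in> carrier (additive_endos TYPE('a))"
    show "\<exists>g\<in>carrier (additive_endos TYPE('a)). g \<oplus>\<^bsub>additive_endos TYPE('a)\<^esub> f = \<zero>\<^bsub>additive_endos TYPE('a)\<^esub>"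
      by (rule bexI[of _ "\<lambda>x. - f x"]) (use f in \<open>auto simp: additive_endos_def\<close>)
  qed (auto simp: additive_endos_def algebra_simps)
  show "monoid (additive_endos TYPE('a))"
    by (rule monoidI) (auto simp: additive_endos_def)
qed (auto simp: additive_endos_def)

lemma minus_additive_endos:
  assumes "f \<in> carrier (additive_endos TYPE('a::ab_group_add))" "g \<in> carrier (additive_endos TYPE('a))"
  shows "f \<ominus>\<^bsub>additive_endos TYPE('a)\<^esub> g = (\<lambda>x. f x - g x)"
proof -
  interpret ring "additive_endos TYPE('a)" by (rule ring_additive_endos)
  have "(\<lambda>x. - g x) = \<ominus>\<^bsub>additive_endos TYPE('a)\<^esub> g"
    using assms(2) by (intro minus_equality[symmetric]) (auto simp: additive_endos_def)
  then show ?thesis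
    unfolding minus_eq by (metis (no_types, lifting) additive_endos_def diff_conv_add_uminus ring.simps(2))
qed

section \<open>The defining relations for the operators on polynomials\<close>

lemma swap_poly_far:
  assumes "\<bar>int i - int j\<bar> > 1"
  shows "swap_poly j (swap_poly i p) = swap_poly i (swap_poly j p)"
  by (induction p rule: zpoly_induct) (use assms in \<open>auto simp: transpose_def\<close>)

lemma demazure_swap_far:
  assumes "\<bar>int i - int j\<bar> > 1"
  shows "demazure_poly j (swap_poly i p) = swap_poly i (demazure_poly j p)"
  by (induction p rule: zpoly_induct) (use assms in \<open>auto simp: transpose_def swap_poly_far\<close>)

lemma demazure_demazure_far:
  assumes "\<bar>int i - int j\<bar> > 1"
  shows "demazure_poly j (demazure_poly i p) = demazure_poly i (demazure_poly j p)"
proof -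
  have "\<bar>int j - int i\<bar> > 1" using assms by simp
  with assms show ?thesis
    by (induction p rule: zpoly_induct) (auto simp: swap_poly_far demazure_swap_far)
qed

text \<open>The relation sD + Ds = s - 1, solved for sD so that it serves as a rewrite rule for the
  quadratic and braid relations.\<close>

lemma swap_demazure:
  "swap_poly i (demazure_poly i p) = swap_poly i p - p - demazure_poly i (swap_poly i p)"
proof (induction p rule: zpoly_induct)
  case (mult p q)
  show ?case by (simp add: mult.IH) (simp add: algebra_simps)
qed (auto simp: transpose_def)

lemma demazure_demazure: "demazure_poly i (demazure_poly i p) = demazure_poly i p"
proof (induction p rule: zpoly_induct)
  \<comment> \<open>Applying D twice to p q gives D q the coefficient s D p + D s p + p, which is s
    p. This is the computation for the square of D \<otimes> 1 + s \<otimes> D, evaluated at p and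
    q.\<close>
  case (mult p q)
  show ?case by (simp add: mult.IH swap_demazure) (simp add: algebra_simps)
qed (auto simp: transpose_def)

lemma swap_poly_braid:
  assumes "\<bar>int i - int j\<bar> = 1"
  shows "swap_poly j (swap_poly i (swap_poly j p)) = swap_poly i (swap_poly j (swap_poly i p))"
proof -
  from assms have "i = j + 1 \<or> j = i + 1" by linarith
  then show ?thesis
    by (induction p rule: zpoly_induct) (auto simp: transpose_def)
qed

lemma demazure_swap_swap:
  assumes "\<bar>int i - int j\<bar> = 1"
  shows "demazure_poly i (swap_poly j (swap_poly i p)) = swap_poly j (swap_poly i (demazure_poly j p))"
proof -
  from assms have "i = j + 1 \<or> j = i + 1" by linarith
  then show ?thesis
    by (induction p rule: zpoly_induct) (auto simp: transpose_def swap_poly_braid[OF assms])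
qed

lemma demazure_braid:
  assumes ij: "\<bar>int i - int j\<bar> = 1"
  shows "demazure_poly j (swap_poly i (demazure_poly j p)) =
    swap_poly i (demazure_poly j (demazure_poly i p)) +
    demazure_poly i (demazure_poly j (swap_poly i p)) +
    swap_poly i (demazure_poly j (swap_poly i p))"
proof -
  have ji: "\<bar>int j - int i\<bar> = 1" using ij by simp
  from ij have "i = j + 1 \<or> j = i + 1" by linarith
  then show ?thesis
  proof (induction p rule: zpoly_induct)
    \<comment> \<open>One term does not match by itself: s_i D_j s_i p times s_i q on the left, and
      times s_i D_i q + D_i s_i q + q on the right. \<open>swap_demazure\<close> for
      \<open>i\<close> identifies the two.\<close>
    case (mult p q)
    show ?case
      by (simp add: mult.IH(1)[OF mult.prems] mult.IH(2)[OF mult.prems] swap_poly_braid[OF ij] demazure_swap_swap[OF ij]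
          demazure_swap_swap[OF ji] swap_demazure[of i])
        (simp add: algebra_simps)
  qed (auto simp: transpose_def)
qed

lemma hecke_relations_poly:
  assumes "(a, b) \<in> hecke_relations n (additive_endos TYPE(zpoly)) swap_poly demazure_poly"
  shows "a = b"
  using assms
proof (induction rule: hecke_relations.induct)
  case (s_D i)
  have "swap_poly i \<in> carrier (additive_endos TYPE(zpoly))" "id \<in> carrier (additive_endos TYPE(zpoly))"
    by (auto simp: additive_endos_def)
  from minus_additive_endos[OF this]
  have "swap_poly i \<ominus>\<^bsub>additive_endos TYPE(zpoly)\<^esub> \<one>\<^bsub>additive_endos TYPE(zpoly)\<^esub> = (\<lambda>p. swap_poly i p - p)"
    by (simp add: additive_endos_def)
  then show ?case by (simp add: additive_endos_def fun_eq_iff swap_demazure)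
qed (simp_all add: additive_endos_def fun_eq_iff swap_poly_far demazure_swap_far demazure_demazure_far
    demazure_demazure swap_poly_braid demazure_swap_swap demazure_braid)

section \<open>Homogeneous components and their invariance\<close>

section \<open>The grading\<close>

definition total_degree :: "('a \<Rightarrow>\<^sub>0 nat) \<Rightarrow> nat" where
  "total_degree m = (\<Sum>i\<in>Poly_Mapping.keys m. Poly_Mapping.lookup m i)"

lemma total_degree_add: "total_degree (m + m') = total_degree m + total_degree m'"
  unfolding total_degree_def by (rule setsum_keys_plus_distrib) simp_all

lemma keys_add_nat:
  "Poly_Mapping.keys (m + m' :: 'a \<Rightarrow>\<^sub>0 nat) = Poly_Mapping.keys m \<union> Poly_Mapping.keys m'"
  by (auto simp: in_keys_iff lookup_add)

text \<open>Membership becomes a condition on the support, which is the form that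
  \<open>frag_induction\<close> consumes.\<close>

lemma graded_component_eq:
  "graded_component n d =
    {p. Poly_Mapping.keys p \<subseteq> {m. Poly_Mapping.keys m \<subseteq> {1..n} \<and> total_degree m = d}}"
  by (auto simp: graded_component_def total_degree_def)

lemma graded_component_zero: "0 \<in> graded_component n d"
  by (simp add: graded_component_eq)

lemma graded_component_diff:
  "p \<in> graded_component n d \<Longrightarrow> q \<in> graded_component n d \<Longrightarrow> p - q \<in> graded_component n d"
  unfolding graded_component_eq using keys_diff[of p q] by blast

lemma graded_component_add:
  "p \<in> graded_component n d \<Longrightarrow> q \<in> graded_component n d \<Longrightarrow> p + q \<in> graded_component n d"
  unfolding graded_component_eq using keys_add[of p q] by blast

lemma graded_component_mult:
  "p \<in> graded_component n d \<Longrightarrow> q \<in> graded_component n e \<Longrightarrow> p * q \<in> graded_component n (d + e)"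
  unfolding graded_component_eq using keys_mult[of p q]
  by (fastforce simp: keys_add_nat total_degree_add)

lemma Var_in_graded_component: "i \<in> {1..n} \<Longrightarrow> Var i \<in> graded_component n 1"
  by (simp add: graded_component_eq Var_def total_degree_def)

text \<open>One variable is split off at a time: D(x_k m) = D(x_k) m + s(x_k) D(m), where D(x_k) is
  0 or plus or minus x_{i+1}, so the degree rises by one in both terms. Since i \<le> n - 1, the
  variables s(x_k) and x_{i+1} stay among the first n.\<close>

lemma frag_of_graded_component:
  assumes i: "i \<in> {1..n-1}" and "Poly_Mapping.keys m \<subseteq> {1..n}"
  shows "swap_poly i (frag_of m) \<in> graded_component n (total_degree m) \<and>
    demazure_poly i (frag_of m) \<in> graded_component n (total_degree m)"
  using assms(2)
proof (induction m rule: monomial_induct)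
  case zero
  have "(1 :: zpoly) \<in> graded_component n 0" by (simp add: graded_component_eq total_degree_def)
  then show ?case by (simp add: graded_component_zero total_degree_def)
next
  case (add_single k m)
  then have k: "k \<in> {1..n}" and m: "Poly_Mapping.keys m \<subseteq> {1..n}" by (auto simp: keys_add_nat)
  then have sk: "transpose i (Suc i) k \<in> {1..n}" and i1: "Suc i \<in> {1..n}"
    using i by (auto simp: transpose_def)
  have deg: "total_degree (Poly_Mapping.single k 1 + m) = 1 + total_degree m"
    by (simp add: total_degree_add) (simp add: total_degree_def)
  have "m' \<in> graded_component n 1" if "m' = demazure_poly i (Var k)" for m'
    using Var_in_graded_component[OF i1] graded_component_diff[OF graded_component_zero, of _ n 1]
      graded_component_zero that by auto
  moreover have "p * q \<in> graded_component n (Suc d)"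
    if "p \<in> graded_component n (Suc 0)" "q \<in> graded_component n d" for p q d
    using graded_component_mult[OF that] by simp
  moreover have "frag_of m \<in> graded_component n (total_degree m)"
    using m by (simp add: graded_component_eq)
  ultimately show ?case
    unfolding deg Var_mult_frag_of[symmetric]
    using add_single.IH[OF m] Var_in_graded_component[OF sk]
    by (simp add: graded_component_add del: demazure_poly_simps(2))
qed

lemma graded_component_invariant:
  assumes "i \<in> {1..n-1}" "p \<in> graded_component n d"
  shows "swap_poly i p \<in> graded_component n d \<and> demazure_poly i p \<in> graded_component n d"
proof -
  have "Poly_Mapping.keys p \<subseteq> {m. Poly_Mapping.keys m \<subseteq> {1..n} \<and> total_degree m = d}"
    using assms(2) by (simp add: graded_component_eq)
  then show ?thesis
    by (induction p rule: frag_induction)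
      (use frag_of_graded_component[OF assms(1)] in \<open>auto simp: graded_component_zero graded_component_diff\<close>)
qed

lemma poly_module_simps [simp]:
  "p \<in> carrier (poly_module n act) \<longleftrightarrow> Poly_Mapping.keys p \<subseteq> {m. Poly_Mapping.keys m \<subseteq> {1..n}}"
  "p \<otimes>\<^bsub>poly_module n act\<^esub> q = p * q" "\<one>\<^bsub>poly_module n act\<^esub> = 1"
  "p \<oplus>\<^bsub>poly_module n act\<^esub> q = p + q" "\<zero>\<^bsub>poly_module n act\<^esub> = 0"
  "h \<odot>\<^bsub>poly_module n act\<^esub> p = act h p"
  by (auto simp: poly_module_def)

lemma graded_component_carrier:
  "p \<in> graded_component n d \<Longrightarrow> p \<in> carrier (poly_module n act)"
  by (auto simp: graded_component_eq)

lemma poly_module_carrier_add: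
  "p \<in> carrier (poly_module n act) \<Longrightarrow> q \<in> carrier (poly_module n act) \<Longrightarrow> p + q \<in> carrier (poly_module n act)"
  using keys_add[of p q] by auto

lemma poly_module_carrier_diff:
  "p \<in> carrier (poly_module n act) \<Longrightarrow> q \<in> carrier (poly_module n act) \<Longrightarrow> p - q \<in> carrier (poly_module n act)"
  using keys_diff[of p q] by auto

lemma ring_poly_module: "ring (poly_module n act)"
proof (rule ringI)
  show "abelian_group (poly_module n act)"
  proof (rule abelian_groupI)
    fix p assume "p \<in> carrier (poly_module n act)"
    then show "\<exists>q\<in>carrier (poly_module n act). q \<oplus>\<^bsub>poly_module n act\<^esub> p = \<zero>\<^bsub>poly_module n act\<^esub>"
      by (intro bexI[of _ "- p"]) simp_all
  next
    fix p q assume "p \<in> carrier (poly_module n act)" "q \<in> carrier (poly_module n act)"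
    then show "p \<oplus>\<^bsub>poly_module n act\<^esub> q \<in> carrier (poly_module n act)"
      using poly_module_carrier_add by simp
  qed (simp_all add: algebra_simps)
  show "monoid (poly_module n act)"
  proof (rule monoidI)
    fix p q assume "p \<in> carrier (poly_module n act)" "q \<in> carrier (poly_module n act)"
    then show "p \<otimes>\<^bsub>poly_module n act\<^esub> q \<in> carrier (poly_module n act)"
      using keys_mult[of p q] by (fastforce simp: keys_add_nat)
  qed (simp_all add: algebra_simps)
qed (simp_all add: algebra_simps)

text \<open>A polynomial may mix degrees, but each of its monomials is sent into the component of
  its own degree, hence into the carrier.\<close>

lemma poly_module_invariant:
  assumes "i \<in> {1..n-1}" "p \<in> carrier (poly_module n act)"
  shows "swap_poly i p \<in> carrier (poly_module n act) \<and> demazure_poly i p \<in> carrier (poly_module n act)"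
proof -
  have "Poly_Mapping.keys p \<subseteq> {m. Poly_Mapping.keys m \<subseteq> {1..n}}" using assms(2) by simp
  then show ?thesis
  proof (induction p rule: frag_induction)
    case (one m)
    then show ?case using frag_of_graded_component[OF assms(1)] graded_component_carrier by blast
  next
    case (diff p q)
    then show ?case unfolding swap_poly_simps demazure_poly_simps by (blast intro: poly_module_carrier_diff)
  qed simp
qed

theorem proposition1p13:
  fixes n :: nat
  assumes "n \<ge> 2"
  shows "\<exists>act :: hecke_elem \<Rightarrow> zpoly \<Rightarrow> zpoly.
    module_algebra (hecke_algebra n) (poly_module n act) (hecke_coproduct n) (hecke_counit n) \<and>
    (\<forall>i\<in>{1..n-1}. \<forall>p\<in>carrier (poly_module n act).
      act (hecke_s n i) p = permute_poly (transpose i (i+1)) p \<and>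
      to_fract (act (hecke_D n i) p) = demazure i p) \<and>
    (\<forall>d. submodule (graded_component n d) (hecke_algebra n) (poly_module n act))"
proof -
  let ?H = "hecke_algebra n" and ?E = "additive_endos TYPE(zpoly)"
  have endo: "swap_poly i \<in> carrier ?E \<and> demazure_poly i \<in> carrier ?E" for i
    by (simp add: additive_endos_def)
  \<comment> \<open>The operators are additive on polynomials in all variables; the restriction to
    x_1, ..., x_n enters with \<open>closed\<close>.\<close>
  obtain act where act: "act \<in> ring_hom ?H ?E"
    and gen: "\<And>i. i \<in> {1..n-1} \<Longrightarrow> act (hecke_s n i) = swap_poly i \<and> act (hecke_D n i) = demazure_poly i"
    by (rule hecke_algebra_extension[of ?E n swap_poly demazure_poly])
      (rule ring_additive_endos endo hecke_relations_poly that | assumption)+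
  interpret act: ring_hom_ring ?H ?E act
    by (intro ring_hom_ringI2 ring_hecke_algebra ring_additive_endos act)
  note [simp del] = act.hom_one act.hom_mult act.hom_add
  have act_add_right: "act h (p + q) = act h p + act h q" if "h \<in> carrier ?H" for h p q
    using act.hom_closed[OF that] by (simp add: additive_endos_def)
  have act_add_left: "act (h \<oplus>\<^bsub>?H\<^esub> k) p = act h p + act k p" if "h \<in> carrier ?H" "k \<in> carrier ?H" for h k p
    using act.hom_add[OF that] by (simp add: additive_endos_def)
  have act_mult: "act (h \<otimes>\<^bsub>?H\<^esub> k) p = act h (act k p)" if "h \<in> carrier ?H" "k \<in> carrier ?H" for h k p
    using act.hom_mult[OF that] by (simp add: additive_endos_def)
  have act_one: "act \<one>\<^bsub>?H\<^esub> p = p" for p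
    using act.hom_one by (simp add: additive_endos_def)
  have act_diff: "act (h \<ominus>\<^bsub>?H\<^esub> k) p = act h p - act k p" if "h \<in> carrier ?H" "k \<in> carrier ?H" for h k p
    using act.hom_minus[OF that] minus_additive_endos[OF act.hom_closed act.hom_closed, OF that] by simp
  \<comment> \<open>Elements of the algebra that preserve a set closed under differences themselves
    form a subring. This is used for the carrier and for each graded component.\<close>
  have invariant: "act h p \<in> V"
    if "h \<in> carrier ?H" "p \<in> V" and diff: "\<And>p q. p \<in> V \<Longrightarrow> q \<in> V \<Longrightarrow> p - q \<in> V"
      and V: "\<And>i p. i \<in> {1..n-1} \<Longrightarrow> p \<in> V \<Longrightarrow> swap_poly i p \<in> V \<and> demazure_poly i p \<in> V" for h p V
    using that(1,2)
    by (induction h arbitrary: p rule: hecke_algebra_induct)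
      (auto simp: act_one act_mult act_diff diff gen V simp del: One_nat_def atLeastAtMost_iff)
  let ?M = "poly_module n act"
  have closed: "act h p \<in> carrier ?M" if "h \<in> carrier ?H" "p \<in> carrier ?M" for h p
    using that poly_module_carrier_diff poly_module_invariant by (rule invariant)
  interpret M: ring ?M by (rule ring_poly_module)
  have "left_module ?H ?M"
    by (intro left_module.intro left_module_axioms.intro ring_hecke_algebra M.abelian_group_axioms)
      (use closed in \<open>auto simp: act_add_left act_add_right act_mult act_one simp del: poly_module_simps(1)\<close>)
  \<comment> \<open>On generators there remain the multiplicativity of the swaps, the product rule
    of the Demazure operators, and their values at 1.\<close>
  then have "module_algebra ?H ?M (hecke_coproduct n) (hecke_counit n)"
    by (rule hecke_module_algebraI[OF _ ring_poly_module])
      (simp_all add: gen del: One_nat_def atLeastAtMost_iff)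
  moreover have "act (hecke_s n i) p = permute_poly (transpose i (i+1)) p \<and>
      to_fract (act (hecke_D n i) p) = demazure i p" if "i \<in> {1..n-1}" for i p
    unfolding gen[OF that, THEN conjunct1] gen[OF that, THEN conjunct2] to_fract_demazure_poly
    by (simp add: swap_poly_def)
  moreover have "submodule (graded_component n d) ?H ?M" for d
  proof (intro submodule.intro submodule_axioms.intro)
    show "subgroup (graded_component n d) (add_monoid ?M)"
    proof (rule M.add.subgroupI)
      show "graded_component n d \<subseteq> carrier ?M"
        by (rule subsetI) (rule graded_component_carrier)
      show "graded_component n d \<noteq> {}" using graded_component_zero by blast
      fix p q assume p: "p \<in> graded_component n d"
      have "- p \<in> graded_component n d"
        using graded_component_diff[OF graded_component_zero p] by simp
      moreover have "\<ominus>\<^bsub>?M\<^esub> p = - p"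
        using p calculation
        by (intro M.minus_equality)
          (auto intro: graded_component_carrier simp del: poly_module_simps(1))
      ultimately show "\<ominus>\<^bsub>?M\<^esub> p \<in> graded_component n d" by simp
      assume "q \<in> graded_component n d"
      with p show "p \<oplus>\<^bsub>?M\<^esub> q \<in> graded_component n d" by (simp add: graded_component_add)
    qed
    fix h p assume "h \<in> carrier ?H" "p \<in> graded_component n d"
    then show "h \<odot>\<^bsub>?M\<^esub> p \<in> graded_component n d"
      using invariant[OF _ _ graded_component_diff graded_component_invariant] by simp
  qed
  ultimately show ?thesis by blast
qed

end
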